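(* Let $n$ be an integer with $6<n\le 33895685$. Then there is no binary sequence of period $n$ all of whose nontrivial autocorrelation values equal $2$, i.e. there is no sequence $\mathbf a=(a_0,a_1,\ldots)$ with $a_j\in\{-1,1\}$, $a_{j+n}=a_j$ for all $j\ge 0$, and $C_{\mathbf a}(t)=2$ for all $1\le t\le n-1$.
   Context: For a sequence $\mathbf a=(a_0,a_1,\ldots)$ with $a_j\in\{-1,1\}$ and $a_{j+n}=a_j$ for all $j\ge0$ (a binary sequence of period $n$), the autocorrelation values are $C_{\mathbf a}(t)=\sum_{i=0}^{n-1}a_ia_{i+t}$ for $0\le t\le n-1$; the values with $1\le t\le n-1$ are called nontrivial. *)

theory Defs
  imports Main
begin

(* n is a period of the sequence, not necessarily the least one. *)
definition binary_sequence :: "nat \<Rightarrow> (nat \<Rightarrow> int) \<Rightarrow> bool" where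
  "binary_sequence n a \<longleftrightarrow> (\<forall>j. a j \<in> {-1, 1}) \<and> (\<forall>j. a (j + n) = a j)"

definition autocorrelation :: "nat \<Rightarrow> (nat \<Rightarrow> int) \<Rightarrow> nat \<Rightarrow> int" where
  "autocorrelation n a t = (\<Sum>i = 0..<n. a i * a (i + t))"

end

theory Submission
  imports Defs "HOL-Library.Poly_Mapping" "HOL-Library.Numeral_Type" "HOL-Number_Theory.Cong"
begin

text \<open>
  Evaluating the sequence at the trivial and at the quadratic character gives \<open>n = 4 m\<^sup>2 + 2\<close>
  with \<open>3 m\<^sup>2 + 1\<close> a square, so in the given range \<open>m\<close> is 4, 15, 56, 209 or 780.
  For odd \<open>w\<close> with \<open>n = 2 w f\<close>, half the image of the sequence in \<open>\<int>[\<int>/w]\<close> is an element \<open>c\<close>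
  with coefficients in \<open>[- f, f]\<close> and \<open>c c\<^sup>* = m\<^sup>2 + f G\<close>, where \<open>G\<close> is the sum of the group.
  Two facts from the arithmetic of cyclotomic fields, obtained here inside the group ring from the
  Frobenius congruence \<open>x\<^sup>p \<equiv> x(g\<^sup>p) (mod p)\<close>, restrict \<open>c\<close>:
  a prime that is self-conjugate modulo \<open>w\<close> divides a shift of \<open>c\<close>, and a residue that is a power
  modulo \<open>w\<close> of every prime dividing \<open>m\<^sup>2\<close> is a multiplier, i.e. it maps \<open>c\<close> to a translate.

  With \<open>w = 33\<close> (\<open>m = 4\<close>) and \<open>w = 41\<close> (\<open>m = 15\<close>) self-conjugacy alone contradicts the bound on the
  coefficients. With \<open>w = 571\<close> (\<open>m = 209\<close>) and \<open>w = 2131\<close> (\<open>m = 780\<close>) self-conjugacy makes the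
  coefficients small, and a multiplier of large order has long orbits, which is incompatible with
  the sum of the coefficients. For \<open>m = 56\<close> take \<open>w = 6273 = 9 \<cdot> 697\<close>: the multiplier
  \<open>2\<^sup>4\<^sup>0 \<equiv> 7\<^sup>1\<^sup>6\<^sup>0\<close> of order 3 is 1 modulo \<open>w / 3\<close>, so \<open>c\<close> is constant on most cosets of the subgroup
  of order 3, and then its autocorrelations at 0 and \<open>w / 3\<close> are too close to each other.
\<close>

section \<open>Frobenius congruences\<close>

lemma freshmans_dream_dvd:
  fixes x y :: "'a :: comm_ring_1"
  assumes "prime p"
  shows "of_nat p dvd (x + y) ^ p - (x ^ p + y ^ p)"
proof -
  have p0: "p > 0" using assms prime_gt_0_nat by blast
  have "(x + y) ^ p = (\<Sum>k\<le>p. of_nat (p choose k) * x ^ k * y ^ (p - k))"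
    by (rule binomial_ring)
  also have "\<dots> = (\<Sum>k\<in>{..p} - {0, p}. of_nat (p choose k) * x ^ k * y ^ (p - k))
      + (\<Sum>k\<in>{0,p}. of_nat (p choose k) * x ^ k * y ^ (p - k))"
    by (rule sum.subset_diff) auto
  also have "(\<Sum>k\<in>{0,p}. of_nat (p choose k) * x ^ k * y ^ (p - k)) = x ^ p + y ^ p"
    using p0 by simp
  finally have "(x + y) ^ p - (x ^ p + y ^ p)
      = (\<Sum>k\<in>{..p} - {0, p}. of_nat (p choose k) * x ^ k * y ^ (p - k))"
    by simp
  moreover have "of_nat p dvd (of_nat (p choose k) * x ^ k * y ^ (p - k) :: 'a)"
    if "k \<in> {..p} - {0, p}" for k
  proof -
    have "p dvd p choose k"
      by (rule dvd_choose_prime) (use that assms in auto)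
    then have "of_nat p dvd (of_nat (p choose k) :: 'a)" by (auto elim!: dvdE)
    then show ?thesis by (simp add: mult.assoc)
  qed
  ultimately show ?thesis by (metis (no_types, lifting) dvd_sum)
qed

lemma freshmans_dream_sum_dvd:
  fixes f :: "'b \<Rightarrow> 'a :: comm_ring_1"
  assumes "prime p" "finite A"
  shows "of_nat p dvd (\<Sum>i\<in>A. f i) ^ p - (\<Sum>i\<in>A. f i ^ p)"
  using assms(2)
proof (induction A rule: finite_induct)
  case empty
  then show ?case using prime_gt_0_nat[OF assms(1)] by (simp add: power_0_left)
next
  case (insert i A)
  have "(f i + (\<Sum>i\<in>A. f i)) ^ p - (f i ^ p + (\<Sum>i\<in>A. f i ^ p))
     = ((f i + (\<Sum>i\<in>A. f i)) ^ p - (f i ^ p + (\<Sum>i\<in>A. f i) ^ p))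
       + ((\<Sum>i\<in>A. f i) ^ p - (\<Sum>i\<in>A. f i ^ p))" by simp
  with dvd_add[OF freshmans_dream_dvd[OF assms(1), of "f i" "\<Sum>i\<in>A. f i"] insert.IH]
  show ?case by (simp only: sum.insert[OF insert.hyps])
qed

lemma fermat_int:
  assumes "prime p"
  shows "int p dvd c ^ p - c"
proof (induction c rule: int_induct[where k = 0])
  case base
  then show ?case using prime_gt_0_nat[OF assms] by (simp add: power_0_left)
next
  case (step1 c)
  have "(c + 1) ^ p - (c + 1) = ((c + 1) ^ p - (c ^ p + 1 ^ p)) + (c ^ p - c)" by simp
  then show ?case using step1 freshmans_dream_dvd[OF assms, of c 1] by (metis dvd_add)
next
  case (step2 c)
  have "(c - 1) ^ p - (c - 1) = (c ^ p - c) - ((c - 1 + 1) ^ p - ((c - 1) ^ p + 1 ^ p))" by simp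
  then show ?case using step2 freshmans_dream_dvd[OF assms, of "c - 1" 1] by (metis dvd_diff)
qed

text \<open>Each further p-th power gains one factor p: in u^p - v^p = (u - v) * S all p summands of
  the cofactor S are congruent to v^(p-1) modulo p, so p divides S.\<close>

lemma dvd_power_prime_power_diff:
  fixes x y :: "'a :: comm_ring_1"
  assumes "prime p" "of_nat p dvd x - y"
  shows "of_nat p ^ Suc k dvd x ^ (p ^ k) - y ^ (p ^ k)"
proof (induction k)
  case 0
  then show ?case using assms by simp
next
  case (Suc k)
  let ?u = "x ^ (p ^ k)" and ?v = "y ^ (p ^ k)"
  have pdvd: "of_nat p dvd ?u - ?v" using Suc by (metis dvd_mult_left power_Suc)
  have "?u ^ p - ?v ^ p = (?u - ?v) * (\<Sum>i<p. ?v ^ (p - Suc i) * ?u ^ i)"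
    by (rule power_diff_sumr2)
  moreover have "of_nat p dvd (\<Sum>i<p. ?v ^ (p - Suc i) * ?u ^ i)"
  proof -
    have "of_nat p dvd ?v ^ (p - Suc i) * ?u ^ i - ?v ^ (p - 1)" if "i < p" for i
    proof -
      have "?v ^ (p - 1) = ?v ^ (p - Suc i) * ?v ^ i"
        using that by (simp flip: power_add)
      then have "?v ^ (p - Suc i) * ?u ^ i - ?v ^ (p - 1) = ?v ^ (p - Suc i) * (?u ^ i - ?v ^ i)"
        by (simp add: algebra_simps)
      moreover have "?u - ?v dvd ?u ^ i - ?v ^ i" by (simp add: power_diff_sumr2)
      ultimately show ?thesis using pdvd by (metis dvd_mult dvd_trans)
    qed
    then have "of_nat p dvd (\<Sum>i<p. ?v ^ (p - Suc i) * ?u ^ i - ?v ^ (p - 1))"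
      by (intro dvd_sum) auto
    then have "of_nat p dvd (\<Sum>i<p. ?v ^ (p - Suc i) * ?u ^ i) - of_nat p * ?v ^ (p - 1)"
      by (simp add: sum_subtractf)
    from dvd_add[OF this dvd_triv_left[of "of_nat p" "?v ^ (p - 1)"]] show ?thesis by simp
  qed
  ultimately have "of_nat p ^ Suc k * of_nat p dvd ?u ^ p - ?v ^ p"
    using Suc by (simp add: mult_dvd_mono)
  then show ?case by (simp add: mult.commute power_mult flip: power_mult)
qed

section \<open>Integral group rings of cyclic groups\<close>

text \<open>The group is the additive group of the finite ring \<open>'g\<close>, later Z/w.
  Products of finitely supported maps are convolutions, so
  \<open>'g \<Rightarrow>\<^sub>0 int\<close> is its integral group ring, and the multiplication of
  \<open>'g\<close> supplies the dilations.\<close>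

abbreviation single :: "'a \<Rightarrow> int \<Rightarrow> ('a \<Rightarrow>\<^sub>0 int)" where
  "single \<equiv> Poly_Mapping.single"

abbreviation lookup :: "('a \<Rightarrow>\<^sub>0 int) \<Rightarrow> 'a \<Rightarrow> int" where
  "lookup \<equiv> Poly_Mapping.lookup"

text \<open>The involution \<open>x \<mapsto> x\<^sup>*\<close> (complex conjugation on characters) is \<open>dil (- 1)\<close>.\<close>

definition dil :: "'g :: {finite, comm_ring_1} \<Rightarrow> ('g \<Rightarrow>\<^sub>0 int) \<Rightarrow> ('g \<Rightarrow>\<^sub>0 int)" where
  "dil u f = (\<Sum>x\<in>UNIV. single (u * x) (lookup f x))"

text \<open>The augmentation, i.e. evaluation at the trivial character.\<close>

definition aug :: "('g :: finite \<Rightarrow>\<^sub>0 int) \<Rightarrow> int" where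
  "aug f = (\<Sum>x\<in>UNIV. lookup f x)"

definition gsum :: "'g :: finite \<Rightarrow>\<^sub>0 int" where
  "gsum = (\<Sum>x\<in>UNIV. single x 1)"

lemma sum_single: "(\<Sum>x\<in>UNIV. single x (lookup f x)) = (f :: 'g :: {finite, comm_ring_1} \<Rightarrow>\<^sub>0 int)"
  by (rule poly_mapping_eqI) (simp add: lookup_sum lookup_single when_def)

lemma single_zero_eq_of_int: "single 0 k = of_int k"
  using single_of_int[of k, where ?'b = int] by simp

section \<open>Dilations as ring endomorphisms\<close>

lemma dil_single [simp]: "dil u (single x c) = single (u * x) c"
proof -
  have "dil u (single x c) = (\<Sum>y\<in>UNIV. if x = y then single (u * y) c else 0)"
    unfolding dil_def by (rule sum.cong) (auto simp: lookup_single when_def)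
  then show ?thesis by simp
qed

lemma dil_0 [simp]: "dil u 0 = 0"
  by (simp add: dil_def)

lemma dil_add: "dil u (f + g) = dil u f + dil u g"
  by (simp add: dil_def lookup_add single_add sum.distrib)

lemma dil_sum: "dil u (\<Sum>i\<in>A. f i) = (\<Sum>i\<in>A. dil u (f i))"
  by (induction A rule: infinite_finite_induct) (simp_all add: dil_add)

lemma dil_uminus: "dil u (- f) = - dil u f"
  by (simp add: dil_def single_uminus sum_negf)

lemma dil_diff: "dil u (f - g) = dil u f - dil u g"
  using dil_add[of u f "- g"] by (simp add: dil_uminus)

lemma dil_mult: "dil u (f * g) = dil u f * dil u g"
proof -
  have "f * g = (\<Sum>x\<in>UNIV. \<Sum>y\<in>UNIV. single (x + y) (lookup f x * lookup g y))"
    by (subst sum_single[of f, symmetric], subst sum_single[of g, symmetric])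
      (simp add: sum_product mult_single)
  also have "dil u \<dots> = (\<Sum>x\<in>UNIV. \<Sum>y\<in>UNIV. single (u * x + u * y) (lookup f x * lookup g y))"
    by (simp add: dil_sum distrib_left)
  also have "\<dots> = dil u f * dil u g"
    by (simp add: dil_def sum_product mult_single)
  finally show ?thesis .
qed

lemma dil_of_int [simp]: "dil u (of_int k) = of_int k"
  using dil_single[of u 0 k] by (simp add: single_zero_eq_of_int)

lemma dil_of_nat [simp]: "dil u (of_nat k) = of_nat k"
  using dil_of_int[of u "int k"] by simp

lemma dil_1 [simp]: "dil u 1 = 1"
  using dil_of_int[of u 1] by simp

lemma dil_power: "dil u (f ^ k) = dil u f ^ k"
  by (induction k) (simp_all add: dil_mult)

lemma dil_dil: "dil u (dil v f) = dil (u * v) f"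
  by (simp add: dil_def[of v] dil_sum) (simp add: dil_def mult.assoc)

lemma dil_one [simp]: "dil 1 f = f"
  by (simp add: dil_def sum_single)

lemma lookup_dil:
  assumes "v * u = 1"
  shows "lookup (dil u f) x = lookup f (v * x)"
proof -
  have *: "u * y = x \<longleftrightarrow> y = v * x" for y
    using assms by (metis mult.assoc mult.commute mult_1)
  have "lookup (dil u f) x = (\<Sum>y\<in>UNIV. if y = v * x then lookup f y else 0)"
    by (simp add: dil_def lookup_sum lookup_single when_def *)
  then show ?thesis by simp
qed

lemma lookup_single_mult: "lookup (single y c * g) x = c * lookup g (x - y :: 'g :: {finite, comm_ring_1})"
proof -
  have "single y c * g = (\<Sum>z\<in>UNIV. single (y + z) (c * lookup g z))"
    by (subst sum_single[of g, symmetric]) (simp add: sum_distrib_left mult_single)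
  moreover have "y + z = x \<longleftrightarrow> z = x - y" for z by (auto simp: algebra_simps)
  ultimately show ?thesis by (simp add: lookup_sum lookup_single when_def)
qed

section \<open>Integer multiples and divisibility, coefficient by coefficient\<close>

lemma lookup_of_int_mult [simp]: "lookup (of_int k * f) x = k * lookup f (x :: 'g :: {finite, comm_ring_1})"
  using lookup_single_mult[of 0 k f x] by (simp add: single_zero_eq_of_int)

lemma lookup_of_nat_mult [simp]: "lookup (of_nat k * f) x = int k * lookup f (x :: 'g :: {finite, comm_ring_1})"
  using lookup_of_int_mult[of "int k"] by simp

lemma lookup_mult_sum: "lookup (f * g) x = (\<Sum>y\<in>UNIV. lookup f y * lookup g (x - y :: 'g :: {finite, comm_ring_1}))"
  by (subst sum_single[of f, symmetric]) (simp add: sum_distrib_right lookup_sum lookup_single_mult)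

lemma lookup_mult_dil_minus:
  "lookup (f * dil (- 1) f) t = (\<Sum>y\<in>UNIV. lookup f y * lookup f (y - t))"
  by (simp add: lookup_mult_sum lookup_dil[of "-1"])

lemma of_int_dvd_iff: "of_int k dvd f \<longleftrightarrow> (\<forall>x. k dvd lookup f (x :: 'g :: {finite, comm_ring_1}))"
proof
  assume "\<forall>x. k dvd lookup f x"
  then have "f = of_int k * (\<Sum>x\<in>UNIV. single x (lookup f x div k))"
    by (intro poly_mapping_eqI) (simp add: lookup_sum lookup_single when_def)
  then show "of_int k dvd f" by (rule dvdI)
qed (auto simp: dvd_def)

lemma of_int_mult_cancel:
  assumes "k \<noteq> 0" "of_int k * f = of_int k * (g :: 'g :: {finite, comm_ring_1} \<Rightarrow>\<^sub>0 int)"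
  shows "f = g"
proof (rule poly_mapping_eqI)
  fix x show "lookup f x = lookup g x"
    using arg_cong[OF assms(2), of "\<lambda>h. lookup h x"] assms(1) by simp
qed

lemma of_int_dvd_cancel:
  assumes "k \<noteq> 0" "of_int (k * l) dvd of_int k * (g :: 'g :: {finite, comm_ring_1} \<Rightarrow>\<^sub>0 int)"
  shows "of_int l dvd g"
  using assms by (simp add: of_int_dvd_iff del: of_int_mult)

section \<open>The group sum and the augmentation\<close>

lemma lookup_gsum [simp]: "lookup gsum (x :: 'g :: {finite, comm_ring_1}) = 1"
  by (simp add: gsum_def lookup_sum lookup_single when_def)

lemma aug_add: "aug (f + g) = aug f + aug (g :: 'g :: {finite, comm_ring_1} \<Rightarrow>\<^sub>0 int)"
  by (simp add: aug_def lookup_add sum.distrib)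

lemma aug_of_int_mult: "aug (of_int k * f) = k * aug (f :: 'g :: {finite, comm_ring_1} \<Rightarrow>\<^sub>0 int)"
  by (simp add: aug_def sum_distrib_left)

lemma aug_gsum: "aug (gsum :: 'g :: {finite, comm_ring_1} \<Rightarrow>\<^sub>0 int) = int CARD('g)"
  by (simp add: aug_def)

lemma mult_gsum: "f * gsum = of_int (aug f) * (gsum :: 'g :: {finite, comm_ring_1} \<Rightarrow>\<^sub>0 int)"
  by (rule poly_mapping_eqI, subst lookup_mult_sum) (simp add: aug_def del: of_int_sum)

lemma dil_gsum:
  assumes "v * u = 1"
  shows "dil u gsum = gsum"
  by (rule poly_mapping_eqI) (simp add: lookup_dil[OF assms])

text \<open>By \<open>mult_gsum\<close> every element acts on \<open>gsum\<close> as its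
  augmentation; evaluate f * g * \<open>gsum\<close> in two ways and read off a coefficient.\<close>

lemma aug_mult: "aug (f * g) = aug f * aug (g :: 'g :: {finite, comm_ring_1} \<Rightarrow>\<^sub>0 int)"
proof -
  have "of_int (aug (f * g)) * gsum = f * (g * gsum)"
    by (simp only: mult_gsum[symmetric] mult.assoc)
  also have "\<dots> = of_int (aug g) * (f * gsum)"
    by (simp only: mult_gsum[of g] mult.left_commute)
  also have "\<dots> = of_int (aug f * aug g) * gsum"
    by (simp only: mult_gsum[of f] of_int_mult) (simp only: ac_simps)
  finally have "of_int (aug (f * g)) * gsum = of_int (aug f * aug g) * (gsum :: 'g \<Rightarrow>\<^sub>0 int)" .
  from arg_cong[OF this, of "\<lambda>h. lookup h 0"] show ?thesis by (simp del: of_int_mult)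
qed

lemma aug_of_int: "aug (of_int k :: 'g :: {finite, comm_ring_1} \<Rightarrow>\<^sub>0 int) = k"
  by (simp add: aug_def lookup_single when_def flip: single_zero_eq_of_int)

lemma aug_dil: "aug (dil u f) = aug f"
proof -
  have "aug (dil u f) = (\<Sum>y\<in>UNIV. \<Sum>x\<in>UNIV. if u * x = y then lookup f x else 0)"
    by (simp add: aug_def dil_def lookup_sum lookup_single when_def)
  also have "\<dots> = (\<Sum>x\<in>UNIV. \<Sum>y\<in>UNIV. if u * x = y then lookup f x else 0)"
    by (rule sum.swap)
  also have "\<dots> = aug f" by (simp add: aug_def)
  finally show ?thesis .
qed

section \<open>Self-conjugate primes and multipliers\<close>

lemma single_power: "single x c ^ k = single (of_nat k * x :: 'g :: {finite, comm_ring_1}) (c ^ k)"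
  by (induction k) (simp_all add: mult_single algebra_simps)

lemma dvd_power_diff: "x - y dvd x ^ k - y ^ k" for x y :: "'a :: comm_ring_1"
  by (simp add: power_diff_sumr2)

lemma dvd_diff_swap: "d dvd x - y \<Longrightarrow> d dvd y - x" for d :: "'a :: comm_ring_1"
  by (metis dvd_minus_iff minus_diff_eq)

text \<open>Modulo p, f^p is the sum of the p-th powers of its monomials. Such a power moves x to p
  x and turns the coefficient k into k^p, which Fermat's theorem replaces by k.\<close>

lemma dil_prime_cong:
  assumes "prime p"
  shows "of_nat p dvd dil (of_nat p) f - f ^ p"
proof -
  have "of_nat p dvd (single (of_nat p * x) (lookup f x) - single x (lookup f x) ^ p)" for x
  proof -
    have "single (of_nat p * x) (lookup f x) - single x (lookup f x) ^ p
      = single (of_nat p * x) (lookup f x - lookup f x ^ p)"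
      by (simp add: single_power single_diff)
    moreover have "int p dvd lookup f x - lookup f x ^ p"
      using fermat_int[OF assms, of "lookup f x"] by (rule dvd_diff_swap)
    ultimately show ?thesis
      using of_int_dvd_iff[of "int p" "single (of_nat p * x) (lookup f x - lookup f x ^ p)"]
      by (simp add: lookup_single when_def)
  qed
  then have "of_nat p dvd (\<Sum>x\<in>UNIV. single (of_nat p * x) (lookup f x) - single x (lookup f x) ^ p)"
    by (rule dvd_sum)
  then have "of_nat p dvd dil (of_nat p) f - (\<Sum>x\<in>UNIV. single x (lookup f x) ^ p)"
    by (simp add: dil_def sum_subtractf)
  moreover have "of_nat p dvd f ^ p - (\<Sum>x\<in>UNIV. single x (lookup f x) ^ p)"
    using freshmans_dream_sum_dvd[OF assms, of UNIV "\<lambda>x. single x (lookup f x)"]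
    by (simp add: sum_single)
  ultimately have "of_nat p dvd (dil (of_nat p) f - (\<Sum>x\<in>UNIV. single x (lookup f x) ^ p))
      - (f ^ p - (\<Sum>x\<in>UNIV. single x (lookup f x) ^ p))"
    by (rule dvd_diff)
  then show ?thesis by simp
qed

lemma dil_prime_power_cong:
  assumes "prime p"
  shows "of_nat p dvd dil (of_nat p ^ i) f - f ^ (p ^ i)"
proof (induction i)
  case (Suc i)
  let ?g = "dil (of_nat p ^ i) f"
  have "of_nat p dvd ?g ^ p - (f ^ (p ^ i)) ^ p"
    using Suc dvd_power_diff dvd_trans by blast
  from dvd_add[OF dil_prime_cong[OF assms, of ?g] this]
  show ?case by (simp add: dil_dil mult.commute flip: power_mult)
qed simp

text \<open>As p^l = 1 in \<open>'g\<close>, the l-fold Frobenius gives f^(p^l) \<equiv> f modulo p,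
  so positive exponents matter only modulo p^l - 1.\<close>

lemma power_prime_power_cong:
  fixes f :: "'g :: {finite, comm_ring_1} \<Rightarrow>\<^sub>0 int"
  assumes "prime p" "of_nat p ^ l = (1 :: 'g)"
  shows "of_nat p dvd f ^ ((p ^ l - 1) * j + 1) - f"
proof (induction j)
  case (Suc j)
  have "p ^ l \<ge> 1" using prime_gt_0_nat[OF assms(1)] by simp
  then have "(p ^ l - 1) * Suc j + 1 = (p ^ l - 1) * j + p ^ l" by simp
  then have eq: "f ^ ((p ^ l - 1) * Suc j + 1) = f ^ ((p ^ l - 1) * j) * f ^ (p ^ l)"
    by (simp only: power_add)
  have "of_nat p dvd f - f ^ (p ^ l)"
    using dil_prime_power_cong[OF assms(1), of l f] assms(2) by simp
  then have "of_nat p dvd f ^ (p ^ l) - f" by (rule dvd_diff_swap)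
  then have "of_nat p dvd f ^ ((p ^ l - 1) * j) * (f ^ (p ^ l) - f)" by (rule dvd_mult)
  from dvd_add[OF this Suc] show ?case by (simp only: eq) (simp add: algebra_simps)
qed simp

text \<open>
  For \<open>K\<close> as below, \<open>x\<^sup>K\<close> is modulo a power of \<open>p\<close> the idempotent of the characters at which \<open>x\<close> is a
  \<open>p\<close>-adic unit. It splits \<open>x\<close> into a part whose cofactor is divisible by the full power of \<open>p\<close> and
  a part \<open>p x\<^sub>1\<close> to which induction applies.
\<close>

lemma dvd_dil_mult_prime:
  fixes x y :: "'g :: {finite, comm_ring_1} \<Rightarrow>\<^sub>0 int"
  assumes p: "prime p" and l: "of_nat p ^ l = (1 :: 'g)" "l > 0"
    and "of_nat p ^ a dvd x * y"
  shows "of_nat p ^ a dvd dil (of_nat p) x * y"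
  using assms(4)
proof (induction a arbitrary: x)
  case (Suc a)
  let ?P = "of_nat p :: 'g \<Rightarrow>\<^sub>0 int" and ?d = "dil (of_nat p)"
  \<comment> \<open>The factor p^l - 1 makes x^(K+1) \<equiv> x modulo p; the factor p^a lifts the
    Frobenius congruence to the modulus p^(a+1).\<close>
  define K where "K = (p ^ l - 1) * p ^ a"
  have "p \<ge> 2" using p prime_ge_2_nat by blast
  then have "p ^ l > 1" using l(2) by (intro one_less_power) auto
  then have K: "K \<ge> 1" using \<open>p \<ge> 2\<close> by (simp add: K_def)
  have "?P dvd x ^ (K + 1) - x"
    unfolding K_def by (rule power_prime_power_cong[OF p l(1)])
  then have "?P dvd x - x ^ (K + 1)" by (rule dvd_diff_swap)
  then obtain x1 where x1: "x - x ^ (K + 1) = ?P * x1" by (elim dvdE)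
  have "x ^ K * y = x ^ (K - 1) * (x * y)"
    using K by (metis mult.assoc power_minus_mult less_eq_Suc_le One_nat_def)
  then have Ky: "?P ^ Suc a dvd x ^ K * y" using Suc.prems by simp
  have "?P * (x1 * y) = (x - x ^ (K + 1)) * y" by (simp only: x1 mult.assoc)
  also have "\<dots> = x * y - x * (x ^ K * y)"
    by (simp add: algebra_simps)
  finally have "?P * (x1 * y) = x * y - x * (x ^ K * y)" .
  then have "?P ^ Suc a dvd ?P * (x1 * y)" using Ky Suc.prems by (simp only: dvd_diff dvd_mult)
  then have "?P ^ a dvd x1 * y"
    using of_int_dvd_cancel[of "int p" "int p ^ a" "x1 * y"] \<open>p \<ge> 2\<close> by simp
  then have IH: "?P ^ Suc a dvd ?P * (?d x1 * y)"
    using Suc.IH by (simp add: mult_dvd_mono)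
  \<comment> \<open>Frobenius gives dil x \<equiv> x^p only modulo p; after raising to the power K
    it holds modulo p^(a+1) and carries the divisibility from x^K y to (dil x)^K y.\<close>
  have "?P ^ Suc a dvd (?d x) ^ (p ^ a) - (x ^ p) ^ (p ^ a)"
    by (rule dvd_power_prime_power_diff[OF p dil_prime_cong[OF p]])
  then have "?P ^ Suc a dvd ((?d x) ^ (p ^ a)) ^ (p ^ l - 1) - ((x ^ p) ^ (p ^ a)) ^ (p ^ l - 1)"
    using dvd_power_diff dvd_trans by blast
  also have "((?d x) ^ (p ^ a)) ^ (p ^ l - 1) = ?d x ^ K"
    by (simp add: K_def mult.commute flip: power_mult)
  also have "((x ^ p) ^ (p ^ a)) ^ (p ^ l - 1) = x ^ (K * p)"
    by (simp add: K_def mult_ac flip: power_mult)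
  finally have "?P ^ Suc a dvd (?d x ^ K - x ^ (K * p)) * y" by (rule dvd_mult2)
  moreover have "?P ^ Suc a dvd x ^ (K * p) * y"
  proof -
    have "K * p = (K * (p - 1)) + K" using \<open>p \<ge> 2\<close> by (simp add: algebra_simps)
    then have "x ^ (K * p) * y = x ^ (K * (p - 1)) * (x ^ K * y)"
      by (simp add: power_add mult.assoc)
    then show ?thesis using Ky by (simp only: dvd_mult)
  qed
  ultimately have "?P ^ Suc a dvd (?d x ^ K - x ^ (K * p)) * y + x ^ (K * p) * y"
    by (rule dvd_add)
  then have "?P ^ Suc a dvd ?d x ^ K * y" by (simp add: algebra_simps)
  from dvd_add[OF dvd_mult[OF this] IH]
  have "?P ^ Suc a dvd ?d x * (?d x ^ K * y) + ?P * (?d x1 * y)" .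
  \<comment> \<open>The splitting of x is carried over by the dilation; both parts, multiplied by y,
    are already known to be divisible.\<close>
  moreover have "?d x = ?d x ^ (K + 1) + ?P * ?d x1"
    using arg_cong[OF x1, of ?d] by (simp only: dil_diff dil_mult dil_power dil_of_nat) (simp add: algebra_simps)
  then have "?d x * y = (?d x ^ (K + 1) + ?P * ?d x1) * y" by simp
  then have "?d x * y = ?d x * (?d x ^ K * y) + ?P * (?d x1 * y)" by (simp only: algebra_simps) simp
  ultimately show ?case by simp
qed simp

lemma dvd_dil_mult_prime_power:
  fixes x y :: "'g :: {finite, comm_ring_1} \<Rightarrow>\<^sub>0 int"
  assumes "prime p" "of_nat p ^ l = (1 :: 'g)" "l > 0" "of_nat p ^ a dvd x * y"
  shows "of_nat p ^ a dvd dil (of_nat p ^ i) x * y"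
proof (induction i)
  case (Suc i)
  from dvd_dil_mult_prime[OF assms(1-3) Suc] show ?case by (simp add: dil_dil)
qed (use assms in simp)

text \<open>Modulo p the conjugate of y is y^(p^j), so p divides y^(p^j + 1). The larger power
  y^(p^(2j)) is congruent to y, because p^(2j) = 1 in \<open>'g\<close>; hence p divides y. Divide y
  by p and repeat.\<close>

lemma self_conjugate_dvd:
  fixes y :: "'g :: {finite, comm_ring_1} \<Rightarrow>\<^sub>0 int"
  assumes p: "prime p" and j: "of_nat p ^ j = (- 1 :: 'g)" "j > 0"
    and "of_nat p ^ (2 * k) dvd y * dil (- 1) y"
  shows "of_nat p ^ k dvd y"
  using assms(4)
proof (induction k arbitrary: y)
  case (Suc k)
  let ?P = "of_nat p :: 'g \<Rightarrow>\<^sub>0 int"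
  have "p \<ge> 2" using p prime_ge_2_nat by blast
  have "?P dvd ?P ^ (2 * Suc k)" by simp
  then have "?P dvd y * dil (- 1) y" using Suc.prems dvd_trans by blast
  moreover have "?P dvd dil (- 1) y - y ^ (p ^ j)"
    using dil_prime_power_cong[OF p, of j y] j by simp
  then have "?P dvd y * (dil (- 1) y - y ^ (p ^ j))" by (rule dvd_mult)
  ultimately have "?P dvd y * dil (- 1) y - y * (dil (- 1) y - y ^ (p ^ j))" by (rule dvd_diff)
  then have *: "?P dvd y ^ (p ^ j + 1)" by (simp add: algebra_simps)
  have "of_nat p ^ (2 * j) = (1 :: 'g)" using j by (simp add: power_mult mult.commute[of 2] power2_eq_square)
  from power_prime_power_cong[OF p this, of y 1]
  have "?P dvd y ^ (p ^ (2 * j)) - y" using \<open>p \<ge> 2\<close> by simp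
  moreover have "p ^ j + 1 \<le> p ^ (2 * j)"
  proof -
    have "p ^ j \<ge> 2" using j(2) \<open>p \<ge> 2\<close> by (metis le_trans self_le_power less_eq_Suc_le One_nat_def Suc_1 Suc_leD)
    then have "p ^ j + 1 \<le> p ^ j * p ^ j" by (metis add_le_mono le_trans mult_2 mult_le_mono1 one_le_numeral order_refl)
    then show ?thesis by (simp add: mult_2 power_add)
  qed
  then have "?P dvd y ^ (p ^ (2 * j))" using * by (meson dvd_trans le_imp_power_dvd)
  ultimately have "?P dvd y" by (metis dvd_diff diff_diff_eq2 add_diff_cancel_left' )
  then obtain y' where y': "y = ?P * y'" by (elim dvdE)
  have "y * dil (- 1) y = ?P ^ 2 * (y' * dil (- 1) y')"
    by (simp add: y' dil_mult power2_eq_square mult_ac)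
  then have "?P ^ 2 * ?P ^ (2 * k) dvd ?P ^ 2 * (y' * dil (- 1) y')"
    using Suc.prems by (simp flip: power_add)
  then have "?P ^ (2 * k) dvd y' * dil (- 1) y'"
    using of_int_dvd_cancel[of "int p ^ 2" "int p ^ (2 * k)" "y' * dil (- 1) y'"] \<open>p \<ge> 2\<close> by simp
  then have "?P ^ k dvd y'" by (rule Suc.IH)
  then show ?case by (simp add: y' mult_dvd_mono)
qed simp

lemma aug_dil_minus_mult: "aug (z * dil (- 1) z) = aug z ^ 2"
  by (simp add: aug_mult aug_dil power2_eq_square)

text \<open>The coefficient at 0 of h h* is the sum of the squared coefficients of h; being 1, it
  leaves a single nonzero coefficient.\<close>

lemma unit_if_mult_dil_minus_eq_1:
  fixes h :: "'g :: {finite, comm_ring_1} \<Rightarrow>\<^sub>0 int"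
  assumes "h * dil (- 1) h = 1"
  obtains e where "h = single e (aug h)" "aug h ^ 2 = 1"
proof -
  have sq: "(\<Sum>y\<in>UNIV. (lookup h y)\<^sup>2) = 1"
    using arg_cong[OF assms, of "\<lambda>f. lookup f 0"]
    by (simp add: lookup_mult_dil_minus power2_eq_square)
  have "\<exists>e. lookup h e \<noteq> 0"
  proof (rule ccontr)
    assume "\<not> ?thesis"
    then show False using sq by simp
  qed
  then obtain e where e: "lookup h e \<noteq> 0" by blast
  have "(lookup h e)\<^sup>2 + (\<Sum>y\<in>UNIV - {e}. (lookup h y)\<^sup>2) = 1"
    using sq by (simp add: sum.remove[of UNIV e])
  moreover have "(lookup h e)\<^sup>2 \<ge> 1" using e by (simp add: int_one_le_iff_zero_less)
  moreover have "(\<Sum>y\<in>UNIV - {e}. (lookup h y)\<^sup>2) \<ge> 0" by (simp add: sum_nonneg)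
  ultimately have "(\<Sum>y\<in>UNIV - {e}. (lookup h y)\<^sup>2) = 0" by linarith
  then have "\<forall>y\<in>UNIV - {e}. (lookup h y)\<^sup>2 = 0" by (subst (asm) sum_nonneg_eq_0_iff) auto
  then have h: "h = single e (lookup h e)"
    by (intro poly_mapping_eqI) (auto simp: lookup_single when_def)
  have "aug h = lookup h e" by (subst h) (simp add: aug_def lookup_single when_def)
  moreover have "aug h ^ 2 = 1"
    using arg_cong[OF assms, of aug] aug_of_int[of 1, where ?'g = 'g] by (simp add: aug_dil_minus_mult)
  ultimately show ?thesis using that h by metis
qed

text \<open>Write the product of \<open>dil t z\<close> and z* as M F and put h = F - \<kappa> G.
  Then h h* = 1 and h has augmentation 1, so h is a group element e. Multiplying F by z shows that e
  translates z to \<open>dil t z\<close>.\<close>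

lemma multiplier:
  fixes z :: "'g :: {finite, comm_ring_1} \<Rightarrow>\<^sub>0 int"
  assumes M: "M \<noteq> 0" and nz: "aug z \<noteq> 0" and vt: "v * t = 1"
    and z: "z * dil (- 1) z = of_int M * (1 + of_int \<kappa> * gsum)"
    and dvd: "of_int M dvd dil t z * dil (- 1) z"
  obtains e where "dil t z = single e 1 * z"
proof -
  define w where "w = int CARD('g)"
  from dvd obtain F where F: "dil t z * dil (- 1) z = of_int M * F" by (elim dvdE)
  have S: "aug z ^ 2 = M * (1 + \<kappa> * w)"
    using arg_cong[OF z, of aug]  aug_of_int[of 1, where ?'g = 'g]
    by (simp add: aug_dil_minus_mult aug_of_int_mult aug_add aug_gsum w_def)
  have "aug z ^ 2 = M * aug F"
    using arg_cong[OF F, of aug] by (simp only: aug_of_int_mult aug_mult[of "dil t z"] aug_dil power2_eq_square)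
  with S M have augF: "aug F = 1 + \<kappa> * w" by simp
  have mm: "(- 1) * (- 1) = (1 :: 'g)" by simp
  define G where "G = (gsum :: 'g \<Rightarrow>\<^sub>0 int)"
  have "G * G = of_int w * G" using mult_gsum[of gsum] by (simp only: aug_gsum w_def G_def)
  moreover have "F * G = of_int (1 + \<kappa> * w) * G"
    using mult_gsum[of F] by (simp only: augF G_def)
  moreover have "dil (- 1) F * G = of_int (1 + \<kappa> * w) * G"
    using mult_gsum[of "dil (- 1) F"] by (simp only: augF aug_dil G_def)
  moreover have "dil (- 1) G = G" "dil t G = G"
    using dil_gsum[OF mm] dil_gsum[OF vt] by (simp_all only: G_def)
  ultimately have G: "G * G = of_int w * G" "F * G = of_int (1 + \<kappa> * w) * G"
    "dil (- 1) F * G = of_int (1 + \<kappa> * w) * G" "dil (- 1) G = G" "dil t G = G"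
    by blast+
  \<comment> \<open>Regroup the four factors of F F* as \<open>dil t\<close> of z z*, times z z*;
    both are known, and G is fixed by the dilation.\<close>
  have "of_int (M * M) * (F * dil (- 1) F) = (of_int M * F) * dil (- 1) (of_int M * F)"
    by (simp add: dil_mult mult_ac)
  also have "\<dots> = (dil t z * dil (- 1) z) * dil (- 1) (dil t z * dil (- 1) z)"
    by (simp only: F)
  also have "\<dots> = dil t (z * dil (- 1) z) * (z * dil (- 1) z)"
    by (simp add: dil_mult dil_dil mult_ac)
  also have "\<dots> = of_int (M * M) * ((1 + of_int \<kappa> * G) * (1 + of_int \<kappa> * G))"
    by (simp only: z dil_mult dil_add dil_of_int dil_1 G_def[symmetric] G) (simp add: mult_ac)
  finally have FF: "F * dil (- 1) F = (1 + of_int \<kappa> * G) * (1 + of_int \<kappa> * G)"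
    by (rule of_int_mult_cancel[rotated]) (use M in simp)
  have FF': "F * dil (- 1) F = 1 + 2 * of_int \<kappa> * G + of_int \<kappa> * of_int \<kappa> * (G * G)"
    by (simp add: FF algebra_simps)
  define h where "h = F - of_int \<kappa> * G"
  have "h * dil (- 1) h = F * dil (- 1) F - of_int \<kappa> * (F * G) - of_int \<kappa> * (dil (- 1) F * G)
      + of_int \<kappa> * of_int \<kappa> * (G * G)"
    by (simp only: h_def dil_diff dil_mult dil_of_int G(4)) (simp add: algebra_simps)
  also have "\<dots> = 1"
    by (simp only: FF' G) (simp add: algebra_simps)
  finally have hh: "h * dil (- 1) h = 1" .
  have "F = h + of_int \<kappa> * G" by (simp add: h_def)
  from arg_cong[OF this, of aug] have augh: "aug h = 1"
    by (simp add: aug_add aug_of_int_mult augF G_def aug_gsum w_def)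
  from unit_if_mult_dil_minus_eq_1[OF hh] augh obtain e where e: "h = single e 1" by metis
  have zG: "z * G = of_int (aug z) * G" "dil t z * G = of_int (aug z) * G"
    using mult_gsum[of z] mult_gsum[of "dil t z"] by (simp_all only: G_def aug_dil)
  \<comment> \<open>Evaluate M F z a second way, pairing z with z*; the terms in G then cancel
    because z and \<open>dil t z\<close> have the same augmentation.\<close>
  have "of_int M * (F * z) = (of_int M * F) * z" by (simp add: mult.assoc)
  also have "\<dots> = dil t z * (z * dil (- 1) z)"
    by (simp only: F[symmetric]) (simp only: mult_ac)
  also have "\<dots> = of_int M * (dil t z * (1 + of_int \<kappa> * G))"
    by (simp add: z G_def mult_ac)
  finally have "F * z = dil t z * (1 + of_int \<kappa> * G)"
    by (rule of_int_mult_cancel[OF M])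
  then have "single e 1 * z + of_int \<kappa> * (z * G) = dil t z + of_int \<kappa> * (dil t z * G)"
    by (simp add: e[symmetric] h_def algebra_simps)
  then have "dil t z = single e 1 * z" by (simp add: zG)
  then show ?thesis by (rule that)
qed

section \<open>Folding a sequence into a group ring\<close>

lemma sum_periodic_shift:
  fixes g :: "nat \<Rightarrow> 'a :: ab_group_add"
  assumes "\<And>j. g (j + n) = g j"
  shows "(\<Sum>u<n. g (u + k)) = (\<Sum>j<n. g j)"
proof (induction k)
  case (Suc k)
  have "g k + (\<Sum>u<n. g (Suc u + k)) = (\<Sum>u<n. g (u + k)) + g (n + k)"
    using sum.lessThan_Suc_shift[of "\<lambda>u. g (u + k)" n] by simp
  then have "(\<Sum>u<n. g (Suc u + k)) = (\<Sum>u<n. g (u + k))"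
    using assms[of k] by (simp add: add.commute)
  then show ?case using Suc by simp
qed simp

text \<open>Stated for any commutative ring, to serve \<omega> = 1 and -1 in the integers as well as
  a generator of the cyclic group inside its group ring. With j = u + k the autocorrelations become
  the coefficients of \<omega>^u: n at u = 0 and 2 elsewhere.\<close>

lemma transform_mult_conjugate:
  fixes \<omega> \<omega>' :: "'a :: comm_ring_1"
  assumes bin: "binary_sequence n a"
    and ac: "\<forall>t \<in> {1..n - 1}. autocorrelation n a t = 2"
    and "n > 0" "\<omega> * \<omega>' = 1" "\<omega> ^ n = 1"
  shows "(\<Sum>j<n. of_int (a j) * \<omega> ^ j) * (\<Sum>k<n. of_int (a k) * \<omega>' ^ k)
    = of_int (int n - 2) + 2 * (\<Sum>u<n. \<omega> ^ u)"
proof -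
  have per: "a (j + n) = a j" for j using bin by (simp add: binary_sequence_def)
  have "a j = 1 \<or> a j = - 1" for j using bin by (auto simp: binary_sequence_def)
  then have a2: "a j * a j = 1" for j by (metis mult_1 mult_minus1 minus_minus)
  have ac0: "autocorrelation n a 0 = int n" by (simp add: autocorrelation_def a2)
  have "(\<Sum>j<n. of_int (a j) * \<omega> ^ j) * (\<Sum>k<n. of_int (a k) * \<omega>' ^ k)
     = (\<Sum>k<n. (\<Sum>j<n. of_int (a j) * \<omega> ^ j) * (of_int (a k) * \<omega>' ^ k))"
    by (simp add: sum_distrib_left)
  also have "\<dots> = (\<Sum>k<n. (\<Sum>u<n. of_int (a (u + k)) * \<omega> ^ (u + k)) * (of_int (a k) * \<omega>' ^ k))"
    by (subst sum_periodic_shift) (simp_all add: per power_add assms)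
  also have "\<dots> = (\<Sum>k<n. \<Sum>u<n. of_int (a k * a (k + u)) * \<omega> ^ u)"
  proof (intro sum.cong refl, subst sum_distrib_right, intro sum.cong refl)
    fix k u
    have "\<omega> ^ (u + k) * \<omega>' ^ k = \<omega> ^ u * (\<omega> * \<omega>') ^ k"
      by (simp add: power_add power_mult_distrib mult.assoc)
    then have *: "\<omega> ^ (u + k) * \<omega>' ^ k = \<omega> ^ u" using assms by simp
    have "of_int (a (u + k)) * \<omega> ^ (u + k) * (of_int (a k) * \<omega>' ^ k)
      = of_int (a k * a (k + u)) * (\<omega> ^ (u + k) * \<omega>' ^ k)"
      by (simp add: mult_ac add.commute)
    then show "of_int (a (u + k)) * \<omega> ^ (u + k) * (of_int (a k) * \<omega>' ^ k)
      = of_int (a k * a (k + u)) * \<omega> ^ u" by (simp only: *)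
  qed
  also have "\<dots> = (\<Sum>u<n. of_int (autocorrelation n a u) * \<omega> ^ u)"
    by (subst sum.swap) (simp add: autocorrelation_def sum_distrib_right atLeast0LessThan)
  also have "\<dots> = (\<Sum>u<n. (if u = 0 then of_int (int n - 2) else 0) + 2 * \<omega> ^ u)"
  proof (intro sum.cong refl)
    fix u assume "u \<in> {..<n}"
    then show "of_int (autocorrelation n a u) * \<omega> ^ u
        = (if u = 0 then of_int (int n - 2) else 0) + 2 * \<omega> ^ u"
      using ac ac0 by (cases "u = 0") auto
  qed
  also have "\<dots> = of_int (int n - 2) + 2 * (\<Sum>u<n. \<omega> ^ u)"
    using \<open>n > 0\<close> by (simp add: sum.distrib sum_distrib_left)
  finally show ?thesis .
qed

lemma sequence_parameters:
  assumes bin: "binary_sequence n a"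
    and ac: "\<forall>t \<in> {1..n - 1}. autocorrelation n a t = 2"
    and "n > 2"
  obtains m r :: nat where "n = 4 * m\<^sup>2 + 2" "r\<^sup>2 = 3 * m\<^sup>2 + 1"
proof -
  have "a j = 1 \<or> a j = - 1" for j using bin by (auto simp: binary_sequence_def)
  then have a: "odd (a j)" for j by (metis odd_one even_minus)
  \<comment> \<open>The value 2 is a sum of n odd terms, so n is even and the character j \<mapsto>
    (-1)^j is available.\<close>
  have "autocorrelation n a 1 = 2" using ac \<open>n > 2\<close> by simp
  moreover have "even (autocorrelation n a 1) \<longleftrightarrow> even n"
    by (simp add: autocorrelation_def even_sum_iff a)
  ultimately have "even n" by simp
  define s where "s = (\<Sum>j<n. a j)"
  have s: "s\<^sup>2 = 3 * int n - 2"
    using transform_mult_conjugate[OF bin ac, of "1 :: int" 1] \<open>n > 2\<close>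
    by (simp add: s_def power2_eq_square)
  define e where "e = (\<Sum>j<n. a j * (- 1) ^ j)"
  have "(\<Sum>u<n. (- 1) ^ u) = (0 :: int)"
    using power_diff_1_eq[of "- 1 :: int" n] \<open>even n\<close> by simp
  then have e: "e\<^sup>2 = int n - 2"
    using transform_mult_conjugate[OF bin ac, of "-1 :: int" "-1"] \<open>n > 2\<close> \<open>even n\<close>
    by (simp add: e_def power2_eq_square)
  have "even (e\<^sup>2)" "even (s\<^sup>2)" unfolding e s using \<open>even n\<close> by simp_all
  then have "even e" "even s" by simp_all
  then obtain e' s' where "e = 2 * e'" "s = 2 * s'" by (auto elim!: evenE)
  then have *: "int n = 4 * e'\<^sup>2 + 2" "s'\<^sup>2 = 3 * e'\<^sup>2 + 1"
    using e s by (simp_all add: power_mult_distrib)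
  show ?thesis
  proof (rule that[of "nat \<bar>e'\<bar>" "nat \<bar>s'\<bar>"])
    have "int n = int (4 * (nat \<bar>e'\<bar>)\<^sup>2 + 2)" using * by simp
    then show "n = 4 * (nat \<bar>e'\<bar>)\<^sup>2 + 2" by presburger
    have "int ((nat \<bar>s'\<bar>)\<^sup>2) = int (3 * (nat \<bar>e'\<bar>)\<^sup>2 + 1)" using * by simp
    then show "(nat \<bar>s'\<bar>)\<^sup>2 = 3 * (nat \<bar>e'\<bar>)\<^sup>2 + 1" by presburger
  qed
qed

text \<open>Characteristic equal to cardinality means that 1 generates the additive group; this is
  how cyclicity is expressed.\<close>

lemma bij_betw_of_nat:
  fixes ty :: "'g :: {finite, comm_ring_1} itself"
  assumes "CHAR('g) = CARD('g)"
  shows "bij_betw (of_nat :: nat \<Rightarrow> 'g) {..<CARD('g)} UNIV"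
proof -
  have "inj_on (of_nat :: nat \<Rightarrow> 'g) {..<CARD('g)}"
  proof (rule linorder_inj_onI)
    fix i j assume "i < j" "i \<in> {..<CARD('g)}" "j \<in> {..<CARD('g)}"
    then show "(of_nat i :: 'g) \<noteq> of_nat j"
      using of_nat_eq_iff_char_dvd[of i j, where ?'a = 'g] assms by (auto dest: dvd_imp_le)
  qed auto
  then show ?thesis
    by (simp add: bij_betw_def card_image card_subset_eq[of UNIV])
qed

lemma sum_single_of_nat:
  fixes ty :: "'g :: {finite, comm_ring_1} itself"
  assumes "CHAR('g) = CARD('g)"
  shows "(\<Sum>u<CARD('g) * k. single (of_nat u) 1) = of_nat k * (gsum :: 'g \<Rightarrow>\<^sub>0 int)"
proof (induction k)
  case (Suc k)
  let ?w = "CARD('g)"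
  have gs: "(\<Sum>u<?w. single (of_nat u :: 'g) 1) = gsum"
    unfolding gsum_def by (rule sum.reindex_bij_betw[OF bij_betw_of_nat[OF assms]])
  have w0: "of_nat ?w = (0 :: 'g)" using assms by (metis of_nat_CHAR)
  have per: "single (of_nat (j + ?w * k) :: 'g) 1 = single (of_nat j) 1" for j
    using w0 by simp
  have "(\<Sum>u<?w * Suc k. single (of_nat u :: 'g) 1)
      = (\<Sum>u<?w * k. single (of_nat u :: 'g) 1) + (\<Sum>u\<in>{?w * k..<?w * k + ?w}. single (of_nat u :: 'g) 1)"
    by (subst sum.union_disjoint[symmetric]) (auto intro!: arg_cong2[of _ _ _ _ sum])
  also have "(\<Sum>u\<in>{?w * k..<?w * k + ?w}. single (of_nat u :: 'g) 1)
      = (\<Sum>u<?w. single (of_nat (u + ?w * k) :: 'g) 1)"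
    using sum.shift_bounds_nat_ivl[of "\<lambda>u. single (of_nat u :: 'g) 1" 0 "?w * k" ?w]
    by (simp add: add.commute atLeast0LessThan)
  also have "\<dots> = gsum" by (simp only: per gs)
  finally show ?case using Suc by (simp add: algebra_simps)
qed simp

text \<open>Each residue class contains 2 f of the n indices, so its coefficient in the image B is a
  sum of 2 f signs: even, and at most 2 f in absolute value. Take c as B / 2, up to the sign that
  makes its augmentation nonnegative.\<close>

lemma fold_sequence:
  fixes ty :: "'g :: {finite, comm_ring_1} itself"
  assumes bin: "binary_sequence n a"
    and ac: "\<forall>t \<in> {1..n - 1}. autocorrelation n a t = 2"
    and char: "CHAR('g) = CARD('g)"
    and n: "n = 4 * m\<^sup>2 + 2" "n = 2 * CARD('g) * f"
  obtains c :: "'g \<Rightarrow>\<^sub>0 int" where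
    "c * dil (- 1) c = of_nat (m\<^sup>2) + of_nat f * gsum" "aug c \<ge> 0" "\<And>x. \<bar>lookup c x\<bar> \<le> int f"
proof -
  define B where "B = (\<Sum>j<n. of_int (a j) * single (1 :: 'g) 1 ^ j)"
  have w0: "of_nat CARD('g) = (0 :: 'g)" using char by (metis of_nat_CHAR)
  have n': "n = CARD('g) * (2 * f)" using n by simp
  have pow: "single x 1 ^ j = single (of_nat j * x :: 'g) 1" for x j by (simp add: single_power)
  have sum1: "(\<Sum>u<n. single (1 :: 'g) 1 ^ u) = of_nat (2 * f) * gsum"
    using sum_single_of_nat[OF char, of "2 * f"] by (simp add: pow n')
  have dB: "dil (- 1) B = (\<Sum>j<n. of_int (a j) * single (- 1) 1 ^ j)"
    by (simp add: B_def dil_sum dil_mult dil_power)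
  have BB: "B * dil (- 1) B = of_int (int n - 2) + 2 * (of_nat (2 * f) * gsum)"
    unfolding dB unfolding B_def sum1[symmetric]
  proof (rule transform_mult_conjugate[OF bin ac])
    show "single (1 :: 'g) 1 ^ n = 1" by (simp add: pow n' w0)
  qed (use n in \<open>simp_all add: mult_single\<close>)
  have look: "lookup B x = (\<Sum>j<n. if of_nat j = x then a j else 0)" for x
    unfolding B_def lookup_sum
    by (intro sum.cong) (auto simp: pow lookup_single when_def)
  have count: "(\<Sum>j<n. if of_nat j = x then 1 else 0) = int (2 * f)" for x :: 'g
    using arg_cong[OF sum1, of "\<lambda>h. lookup h x"]
    by (simp add: lookup_sum pow lookup_single when_def eq_commute[of _ x] del: of_nat_mult)
  have aj: "a j = 1 \<or> a j = - 1" for j using bin by (auto simp: binary_sequence_def)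
  have "even (lookup B x)" for x
  proof -
    \<comment> \<open>Adding 1 to each sign gives an even number, so the coefficient has the parity
      of the count 2 f.\<close>
    have "even (lookup B x + (\<Sum>j<n. if of_nat j = x then 1 else 0))"
      unfolding look sum.distrib[symmetric] 
    proof (rule dvd_sum)
      show "even ((if of_nat j = x then a j else 0) + (if of_nat j = x then 1 else 0))" for j
        using aj[of j] by auto
    qed
    then show ?thesis unfolding count by simp
  qed
  then have "of_int 2 dvd B" using of_int_dvd_iff by blast
  then obtain c where c: "B = of_int 2 * c" by (elim dvdE)
  have "\<bar>lookup B x\<bar> \<le> (\<Sum>j<n. \<bar>if of_nat j = x then a j else 0\<bar>)" for x
    unfolding look by (rule sum_abs)
  also have "\<dots> x \<le> (\<Sum>j<n. if of_nat j = x then 1 else 0)" for x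
  proof (rule sum_mono)
    show "\<bar>if of_nat j = x then a j else 0\<bar> \<le> (if of_nat j = x then 1 else 0)" for j
      using aj[of j] by auto
  qed
  finally have B_le: "\<bar>lookup B x\<bar> \<le> int (2 * f)" for x unfolding count .
  have bound: "\<bar>lookup c x\<bar> \<le> int f" for x
    using B_le[of x] by (simp add: c del: of_int_numeral)
  have "of_int 4 * (c * dil (- 1) c) = B * dil (- 1) B"
    by (simp only: c dil_mult dil_of_int) (simp add: algebra_simps)
  also have "\<dots> = of_int 4 * (of_nat (m\<^sup>2) + of_nat f * gsum)"
    unfolding BB using n(1) by (simp add: algebra_simps)
  finally have cc: "c * dil (- 1) c = of_nat (m\<^sup>2) + of_nat f * gsum"
    by (rule of_int_mult_cancel[rotated]) simp
  show ?thesis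
  proof (cases "aug c \<ge> 0")
    case True
    then show ?thesis using that cc bound by blast
  next
    case False
    have "aug (- c) = - aug c" by (simp add: aug_def sum_negf)
    then show ?thesis using that[of "- c"] cc bound False by (simp add: dil_uminus)
  qed
qed

text \<open>Repeated squaring as rewrite rules, to keep the intermediate numerals small.\<close>

lemma power_mod_Bit0:
  "x ^ numeral (num.Bit0 k) mod m = (x ^ numeral k mod m) * (x ^ numeral k mod m) mod (m :: nat)"
  by (simp only: numeral_Bit0 power_add mod_mult_eq)

lemma power_mod_Bit1:
  "x ^ numeral (num.Bit1 k) mod m = (x ^ numeral k mod m) * (x ^ numeral k mod m) mod m * x mod (m :: nat)"
  by (simp only: numeral_Bit1 power_add mod_mult_eq mod_mult_left_eq[of _ m x] power_one_right)

lemmas power_mod_simps = power_mod_Bit0 power_mod_Bit1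

lemma of_nat_power_eqI:
  fixes ty :: "'g :: comm_ring_1 itself"
  assumes "CHAR('g) = w" "p ^ k mod w = b"
  shows "of_nat p ^ k = (of_nat b :: 'g)"
proof -
  have "[p ^ k = b] (mod w)" using assms(2) by (auto simp: cong_def)
  then show ?thesis using assms(1) by (metis of_nat_eq_iff_cong_CHAR of_nat_power)
qed

text \<open>Adding a multiple of \<open>gsum\<close> affects only the trivial character. The free k
  serves to make the \<open>gsum\<close> coefficient of z z* vanish or divisible by the required
  prime powers.\<close>

lemma shift_by_gsum:
  fixes c :: "'g :: {finite, comm_ring_1} \<Rightarrow>\<^sub>0 int"
  assumes "c * dil (- 1) c = of_nat M + of_nat f * gsum"
  defines "z k \<equiv> c + of_int k * gsum"
  shows "(aug c)\<^sup>2 = int M + int f * int CARD('g)"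
    and "z k * dil (- 1) (z k)
      = of_nat M + of_int (int f + 2 * k * aug c + k\<^sup>2 * int CARD('g)) * gsum"
    and "aug (z k) = aug c + k * int CARD('g)"
    and "lookup (z k) x = lookup c x + k"
proof -
  have "aug (of_nat M + of_nat f * gsum :: 'g \<Rightarrow>\<^sub>0 int) = int M + int f * int CARD('g)"
    using aug_of_int[of "int M", where ?'g = 'g] aug_of_int_mult[of "int f" "gsum :: 'g \<Rightarrow>\<^sub>0 int"]
    by (simp add: aug_add aug_gsum)
  then show "(aug c)\<^sup>2 = int M + int f * int CARD('g)"
    using assms(1) aug_dil_minus_mult[of c] by simp
  define G where "G = (gsum :: 'g \<Rightarrow>\<^sub>0 int)"
  have G: "G * G = of_int (int CARD('g)) * G" "c * G = of_int (aug c) * G"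
      "dil (- 1) c * G = of_int (aug c) * G" "dil (- 1) G = G"
    using mult_gsum[of "gsum :: 'g \<Rightarrow>\<^sub>0 int"] mult_gsum[of c] mult_gsum[of "dil (- 1) c"]
      dil_gsum[of "- 1 :: 'g" "- 1"]
    by (simp_all only: aug_gsum aug_dil G_def) simp_all
  have "z k * dil (- 1) (z k)
      = c * dil (- 1) c + of_int k * (c * G) + of_int k * (dil (- 1) c * G) + of_int k * of_int k * (G * G)"
    by (simp only: z_def dil_add dil_mult dil_of_int G(4) flip: G_def) (simp add: algebra_simps)
  also have "\<dots> = of_nat M + of_int (int f + 2 * k * aug c + k\<^sup>2 * int CARD('g)) * G"
    by (simp only: assms(1) G) (simp add: G_def algebra_simps power2_eq_square)
  finally show "z k * dil (- 1) (z k)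
      = of_nat M + of_int (int f + 2 * k * aug c + k\<^sup>2 * int CARD('g)) * gsum"
    by (simp only: G_def)
  show "aug (z k) = aug c + k * int CARD('g)"
    by (simp add: z_def aug_add aug_of_int_mult aug_gsum)
  show "lookup (z k) x = lookup c x + k"
    by (simp add: z_def lookup_add)
qed

lemma self_conjugate_dvd_lookup:
  fixes y :: "'g :: {finite, comm_ring_1} \<Rightarrow>\<^sub>0 int"
  assumes "prime p" "of_nat p ^ j = (- 1 :: 'g)" "j > 0"
    and "y * dil (- 1) y = of_nat M + of_int N * gsum" "p ^ (2 * k) dvd M" "int p ^ (2 * k) dvd N"
  shows "int p ^ k dvd lookup y x"
proof -
  have "of_nat p ^ (2 * k) dvd (of_nat M + of_int N * gsum :: 'g \<Rightarrow>\<^sub>0 int)"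
  proof (intro dvd_add dvd_mult2)
    have "(of_nat (p ^ (2 * k)) :: 'g \<Rightarrow>\<^sub>0 int) dvd of_nat M" using assms(5) by (auto elim!: dvdE)
    then show "(of_nat p ^ (2 * k) :: 'g \<Rightarrow>\<^sub>0 int) dvd of_nat M" by simp
    have "(of_int (int p ^ (2 * k)) :: 'g \<Rightarrow>\<^sub>0 int) dvd of_int N" using assms(6) by (auto elim!: dvdE)
    then show "(of_nat p ^ (2 * k) :: 'g \<Rightarrow>\<^sub>0 int) dvd of_int N" by simp
  qed
  then have "of_nat p ^ (2 * k) dvd y * dil (- 1) y" by (simp only: assms(4))
  then have "of_nat p ^ k dvd y" by (rule self_conjugate_dvd[OF assms(1-3)])
  then show ?thesis using of_int_dvd_iff[of "int p ^ k" y] by simp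
qed

lemma divide_by_of_int:
  fixes z :: "'g :: {finite, comm_ring_1} \<Rightarrow>\<^sub>0 int"
  assumes "z * dil (- 1) z = of_int (d\<^sup>2 * M)" "\<And>x. d dvd lookup z x" "d \<noteq> 0"
  obtains y where "z = of_int d * y" "y * dil (- 1) y = of_int M"
proof -
  from assms(2) have "of_int d dvd z" by (simp add: of_int_dvd_iff)
  then obtain y where y: "z = of_int d * y" by (elim dvdE)
  have "of_int (d\<^sup>2) * (y * dil (- 1) y) = of_int (d\<^sup>2) * of_int M"
    using assms(1) by (simp add: y dil_mult power2_eq_square mult_ac)
  then have "y * dil (- 1) y = of_int M"
    by (rule of_int_mult_cancel[rotated]) (use assms(3) in simp)
  with y show ?thesis using that by blast
qed

lemma prime_char_no_zero_divisors:
  fixes x y :: "'g :: {finite, comm_ring_1}"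
  assumes "CHAR('g) = CARD('g)" "prime CARD('g)" "x * y = 0"
  shows "x = 0 \<or> y = 0"
proof -
  have "\<exists>i. x = of_nat i" for x :: 'g
    using bij_betw_of_nat[OF assms(1)] by (metis UNIV_I bij_betw_imp_surj_on imageE)
  then obtain i j where ij: "x = of_nat i" "y = of_nat j" by metis
  then have "CARD('g) dvd i * j" using assms by (metis of_nat_eq_0_iff_char_dvd of_nat_mult)
  then have "CARD('g) dvd i \<or> CARD('g) dvd j" using assms(2) by (simp add: prime_dvd_mult_iff)
  then show ?thesis unfolding ij using assms(1) by (metis of_nat_eq_0_iff_char_dvd)
qed

section \<open>Orbits of a multiplier\<close>

text \<open>Translating by d changes e to e - (1 - t) d, and 1 - t is invertible because
  \<open>'g\<close> is a field.\<close>

lemma exists_fixed_translate: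
  fixes y :: "'g :: {finite, comm_ring_1} \<Rightarrow>\<^sub>0 int"
  assumes cp: "CHAR('g) = CARD('g)" "prime CARD('g)" and "t \<noteq> 1"
    and y: "dil t y = single e 1 * y"
  obtains d where "dil t (single d 1 * y) = single d 1 * y"
proof -
  have "inj (\<lambda>x. (1 - t) * x)"
  proof (rule injI)
    fix a b assume "(1 - t) * a = (1 - t) * b"
    then have "(1 - t) * (a - b) = 0" by (simp add: algebra_simps)
    then show "a = b" using prime_char_no_zero_divisors[OF cp] \<open>t \<noteq> 1\<close> by fastforce
  qed
  then have "surj (\<lambda>x. (1 - t) * x)" by (simp add: finite_UNIV_inj_surj)
  then obtain d where d: "e = (1 - t) * d" by (metis surjD)
  have "dil t (single d 1 * y) = single (t * d + e) 1 * y"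
    by (simp add: dil_mult y mult_single flip: mult.assoc)
  also have "t * d + e = d" by (simp add: d algebra_simps)
  finally show ?thesis by (rule that)
qed

text \<open>Multiplication by t splits the nonzero elements into orbits of exactly q elements, and F
  is constant on each.\<close>

lemma dvd_sum_free_orbits:
  fixes F :: "'g :: {finite, comm_ring_1} \<Rightarrow> int"
  assumes cp: "CHAR('g) = CARD('g)" "prime CARD('g)"
    and q: "prime q" "t ^ q = 1" "t \<noteq> 1"
    and inv: "\<And>x. F (t * x) = F x"
  shows "int q dvd (\<Sum>x\<in>UNIV - {0}. F x)"
proof -
  \<comment> \<open>As q is prime, a Bezout relation between k and q would turn t^k = 1 into t =
    1.\<close>
  have tk: "t ^ k \<noteq> 1" if "0 < k" "k < q" for k
  proof
    assume "t ^ k = 1"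
    have "coprime k q" using that q(1) by (meson coprime_commute prime_imp_coprime nat_dvd_not_less)
    then obtain a b where "a * k = b * q + 1"
      using that coprime_bezout_strong[of k q] prime_gt_1_nat[OF q(1)] by (metis mult.commute nat_less_le)
    then have "t ^ (a * k) = t ^ (b * q + 1)" by simp
    then have "(t ^ k) ^ a = (t ^ q) ^ b * t" by (simp add: mult.commute flip: power_mult)
    then show False using \<open>t ^ k = 1\<close> q by simp
  qed
  have Fk: "F (t ^ k * x) = F x" for k x
    by (induction k) (simp_all add: inv mult.assoc)
  \<comment> \<open>Induction over invariant sets without 0, removing the orbit of one element at a
    time.\<close>
  have orbits: "int q dvd (\<Sum>x\<in>A. F x)" if "finite A" "0 \<notin> A" "\<And>x. x \<in> A \<Longrightarrow> t * x \<in> A" for A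
    using that
  proof (induction A rule: finite_psubset_induct)
    case (psubset A)
    show ?case
    proof (cases "A = {}")
      case False
      then obtain x where x: "x \<in> A" by blast
      have x0: "x \<noteq> 0" using x psubset.prems by blast
      let ?O = "(\<lambda>k. t ^ k * x) ` {..<q}"
      have inj: "inj_on (\<lambda>k. t ^ k * x) {..<q}"
      proof (rule linorder_inj_onI)
        fix i j assume ij: "i < j" "i \<in> {..<q}" "j \<in> {..<q}"
        show "t ^ i * x \<noteq> t ^ j * x"
        proof
          assume "t ^ i * x = t ^ j * x"
          then have "t ^ (q - i) * (t ^ i * x) = t ^ (q - i) * (t ^ j * x)" by simp
          then have "t ^ (q - i + i) * x = t ^ (q - i + j) * x" by (simp add: power_add mult_ac)
          moreover have "q - i + i = q" "q - i + j = q + (j - i)" using ij by auto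
          ultimately have "t ^ q * x = t ^ (q + (j - i)) * x" by (simp only:)
          then have "1 * x = t ^ (j - i) * x" by (simp only: power_add q mult_1)
          then have "(t ^ (j - i) - 1) * x = 0" by (simp only: left_diff_distrib) simp
          then have "t ^ (j - i) = 1" using prime_char_no_zero_divisors[OF cp] x0 by fastforce
          moreover have "0 < j - i" "j - i < q" using ij by auto
          ultimately show False using tk by blast
        qed
      qed auto
      have OA: "?O \<subseteq> A"
      proof
        fix y assume "y \<in> ?O"
        then obtain k where "y = t ^ k * x" by blast
        moreover have "t ^ k * x \<in> A"
          by (induction k) (use x psubset.prems in \<open>auto simp: mult.assoc\<close>)
        ultimately show "y \<in> A" by simp
      qed
      have "x \<in> ?O" using prime_gt_0_nat[OF q(1)] by (force intro!: image_eqI[of _ _ 0])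
      then have psub: "A - ?O \<subset> A" using x by blast
      have inO: "t ^ k * x \<in> ?O" for k
      proof -
        have "t ^ k = t ^ (q * (k div q) + k mod q)" by simp
        also have "\<dots> = t ^ (k mod q)" by (simp only: power_add power_mult q power_one mult_1)
        finally show ?thesis using prime_gt_0_nat[OF q(1)] by (auto intro!: image_eqI[of _ _ "k mod q"])
      qed
      have "int q dvd (\<Sum>x\<in>A - ?O. F x)"
      proof (rule psubset.IH[OF psub])
        fix y assume y: "y \<in> A - ?O"
        have "t * y \<notin> ?O"
        proof
          assume "t * y \<in> ?O"
          then obtain k where "t * y = t ^ k * x" by blast
          then have "t ^ (q - 1) * (t * y) = t ^ (q - 1 + k) * x"
            by (simp add: power_add mult_ac)
          moreover have "t ^ (q - 1) * t = 1"
            using q power_minus_mult[OF prime_gt_0_nat[OF q(1)], of t] by simp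
          ultimately have "y = t ^ (q - 1 + k) * x" by (metis mult.assoc mult_1)
          then show False using inO y by blast
        qed
        then show "t * y \<in> A - ?O" using y psubset.prems by blast
      qed (use psubset.prems in auto)
      moreover have "(\<Sum>y\<in>?O. F y) = int q * F x"
        by (subst sum.reindex[OF inj]) (simp add: Fk)
      ultimately show ?thesis
        using sum.subset_diff[OF OA psubset.hyps, of F] by simp
    qed simp
  qed
  have nz: "t * x \<noteq> 0" if "x \<noteq> 0" for x
  proof
    assume "t * x = 0"
    then have "t ^ q * x = 0" using prime_gt_0_nat[OF q(1)] by (metis mult.assoc mult_zero_right power_minus_mult)
    then show False using that q by simp
  qed
  show ?thesis by (rule orbits) (use nz in auto)
qed

text \<open>The power t^a has order q and fixes y, and 0 is its only fixed point. Different
  factorizations of one exponent yield different prime divisors q.\<close>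

lemma dvd_aug_minus_center:
  fixes y :: "'g :: {finite, comm_ring_1} \<Rightarrow>\<^sub>0 int"
  assumes cp: "CHAR('g) = CARD('g)" "prime CARD('g)"
    and t: "t ^ (a * q) = 1" "t ^ a \<noteq> 1" "prime q"
    and fixed: "dil t y = y"
  shows "int q dvd aug y - lookup y 0"
proof -
  have aq: "a * q > 0" using t by (metis mult_pos_pos gr0I power_0 prime_gt_0_nat)
  then have v: "t ^ (a * q - 1) * t = 1" using t(1) power_minus_mult[OF aq, of t] by simp
  have inv: "lookup y (t * x) = lookup y x" for x
    using lookup_dil[OF v, of y "t * x"] fixed v by (simp add: mult.assoc[symmetric])
  have inva: "lookup y (t ^ a * x) = lookup y x" for x
    by (induction a) (simp_all add: inv mult.assoc)
  have "int q dvd (\<Sum>x\<in>UNIV - {0}. lookup y x)"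
    by (rule dvd_sum_free_orbits[OF cp t(3), of "t ^ a"]) (use t inva in \<open>simp_all flip: power_mult\<close>)
  then show ?thesis by (simp add: aug_def sum.remove[of UNIV 0])
qed

lemma aug_single_mult: "aug (single d 1 * y) = aug (y :: 'g :: {finite, comm_ring_1} \<Rightarrow>\<^sub>0 int)"
  by (simp add: aug_mult) (simp add: aug_def lookup_single when_def)

text \<open>Trial division; candidates form an explicit list so that simplification can enumerate
  them.\<close>

lemma prime_nat_if_no_small_divisor:
  assumes "1 < p" "p < (Suc k)\<^sup>2" "\<forall>d\<in>set [2..<Suc k]. \<not> d dvd p"
  shows "prime (p :: nat)"
proof (rule ccontr)
  assume "\<not> prime p"
  then obtain a where "a dvd p" "a \<noteq> 1" "a \<noteq> p"
    using assms(1) by (auto simp: prime_nat_iff)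
  moreover then obtain b where "p = a * b" by (elim dvdE)
  ultimately have p: "p = a * b" "1 < a" "1 < b"
    using assms(1) by (auto simp: nat_neq_iff)
  have "\<not> d \<le> k" if "1 < d" "d dvd p" for d
  proof
    assume "d \<le> k"
    with \<open>1 < d\<close> have "d \<in> set [2..<Suc k]" by (simp only: set_upt) simp
    with assms(3) that show False by blast
  qed
  with p have "\<not> a \<le> k" "\<not> b \<le> k" by (metis dvd_triv_left, metis dvd_triv_right)
  then have "Suc k \<le> a" "Suc k \<le> b" by simp_all
  then have "(Suc k)\<^sup>2 \<le> p" unfolding p power2_eq_square by (rule mult_le_mono)
  then show False using assms(2) by simp
qed

lemma of_int_mult_dvd_if_bezout:
  fixes f :: "'g :: {finite, comm_ring_1} \<Rightarrow>\<^sub>0 int"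
  assumes "of_int k dvd f" "of_int l dvd f" "u * k + v * l = 1"
  shows "of_int (k * l) dvd f"
proof -
  have "coprime k l" using assms(3) by (metis coprimeI dvd_add dvd_mult)
  then show ?thesis using assms(1,2) divides_mult unfolding of_int_dvd_iff by blast
qed

section \<open>The five remaining periods\<close>

lemma no_sequence_66:
  assumes bin: "binary_sequence 66 a"
    and ac: "\<forall>t \<in> {1..66 - 1}. autocorrelation 66 a t = 2"
  shows False
proof -
  have char: "CHAR(33) = CARD(33)" by simp
  obtain c :: "33 \<Rightarrow>\<^sub>0 int" where c: "c * dil (- 1) c = of_nat (4\<^sup>2) + of_nat 1 * gsum"
      "aug c \<ge> 0" "\<And>x. \<bar>lookup c x\<bar> \<le> int 1"
    by (rule fold_sequence[OF bin ac char, of 4 1]) auto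
  note S = shift_by_gsum[OF c(1)]
  have "(aug c)\<^sup>2 = 7\<^sup>2" using S(1) by simp
  then have aug: "aug c = 7" using c(2) by (rule power2_eq_imp_eq) simp
  have "lookup c x = - 1" for x
  proof -
    \<comment> \<open>2^5 = -1 modulo 33, and the shift by 1 turns the \<open>gsum\<close>
      coefficient into 1 + 2 * 7 + 33 = 48, divisible by 2^4. Among -1, 0, 1 only -1 then
      remains.\<close>
    have "int 2 ^ 2 dvd lookup (c + of_int 1 * gsum) x"
      by (rule self_conjugate_dvd_lookup[OF _ _ _ S(2), of _ 5]) (simp_all add: aug)
    then have "4 dvd lookup c x + 1" unfolding S(4) by simp
    with c(3)[of x] show ?thesis by presburger
  qed
  then have "aug c = - 33" by (simp add: aug_def)
  with aug show False by simp
qed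

lemma no_sequence_902:
  assumes bin: "binary_sequence 902 a"
    and ac: "\<forall>t \<in> {1..902 - 1}. autocorrelation 902 a t = 2"
  shows False
proof -
  have char: "CHAR(41) = CARD(41)" by simp
  obtain c :: "41 \<Rightarrow>\<^sub>0 int" where c: "c * dil (- 1) c = of_nat (15\<^sup>2) + of_nat 11 * gsum"
      "aug c \<ge> 0" "\<And>x. \<bar>lookup c x\<bar> \<le> int 11"
    by (rule fold_sequence[OF bin ac char, of 15 11]) auto
  note S = shift_by_gsum[OF c(1)]
  have "(aug c)\<^sup>2 = 26\<^sup>2" using S(1) by simp
  then have aug: "aug c = 26" using c(2) by (rule power2_eq_imp_eq) simp
  \<comment> \<open>The shift by -1 removes \<open>gsum\<close>, since 11 - 2 * 26 + 41 = 0;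
    moreover 3^4 = 5^10 = -1 modulo 41.\<close>
  have "int 3 ^ 1 dvd lookup (c + of_int (- 1) * gsum) x" for x
    by (rule self_conjugate_dvd_lookup[OF _ _ _ S(2), of _ 4]) (simp_all add: aug)
  moreover have "int 5 ^ 1 dvd lookup (c + of_int (- 1) * gsum) x" for x
    by (rule self_conjugate_dvd_lookup[OF _ _ _ S(2), of _ 10]) (simp_all add: aug)
  ultimately have dvds: "3 dvd lookup (c + of_int (- 1) * gsum) x \<and> 5 dvd lookup (c + of_int (- 1) * gsum) x" for x
    by simp
  have d15: "15 dvd lookup (c + of_int (- 1) * gsum) x" for x
    using dvds[of x] by presburger
  have "(c + of_int (- 1) * gsum) * dil (- 1) (c + of_int (- 1) * gsum) = of_int (15\<^sup>2 * 1)"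
    using S(2)[of "- 1"] by (simp add: aug)
  then obtain y where y: "c + of_int (- 1) * gsum = of_int 15 * y" "y * dil (- 1) y = of_int 1"
    by (rule divide_by_of_int[OF _ d15 _ that]) simp
  from y(2) have "y * dil (- 1) y = 1" by simp
  then obtain e where e: "y = single e (aug y)" "(aug y)\<^sup>2 = 1"
    by (rule unit_if_mult_dil_minus_eq_1)
  \<comment> \<open>At e the coefficient of c is 1 + 15 or 1 - 15, beyond the bound 11.\<close>
  have "lookup c e - 1 = 15 * lookup y e"
    using S(4)[of "- 1" e] unfolding y(1) lookup_of_int_mult by simp
  moreover have "lookup y e = aug y" by (subst e(1)) simp
  moreover have "aug y = 1 \<or> aug y = - 1" using e(2) by (simp add: power2_eq_1_iff)
  ultimately show False using c(3)[of e] by auto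
qed

lemma no_sequence_174726:
  assumes bin: "binary_sequence 174726 a"
    and ac: "\<forall>t \<in> {1..174726 - 1}. autocorrelation 174726 a t = 2"
  shows False
proof -
  have char: "CHAR(571) = CARD(571)" by simp
  have "prime (571 :: nat)"
    by (rule prime_nat_if_no_small_divisor[of _ 23]) (simp_all add: upt_rec_numeral)
  moreover have "CARD(571) = 571" by simp
  ultimately have prime: "prime CARD(571)" by (simp only:)
  have pow: "of_nat p ^ k = (of_nat b :: 571)" if "p ^ k mod 571 = b" for p k b
    by (rule of_nat_power_eqI[OF _ that]) simp
  obtain c :: "571 \<Rightarrow>\<^sub>0 int" where c: "c * dil (- 1) c = of_nat (209\<^sup>2) + of_nat 153 * gsum"
      "aug c \<ge> 0" "\<And>x. \<bar>lookup c x\<bar> \<le> int 153"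
    by (rule fold_sequence[OF bin ac char, of 209 153]) auto
  note S = shift_by_gsum[OF c(1)]
  have "(aug c)\<^sup>2 = 362\<^sup>2" using S(1) by simp
  then have aug: "aug c = 362" using c(2) by (rule power2_eq_imp_eq) simp
  have "of_nat 19 ^ 285 = (of_nat 570 :: 571)"
    by (rule pow) (simp add: power_mod_simps del: power_numeral)
  also have "of_nat 570 = (- 1 :: 571)" by simp
  finally have pj: "of_nat 19 ^ 285 = (- 1 :: 571)" .
  \<comment> \<open>Again the shift by -1 removes \<open>gsum\<close>: 153 - 2 * 362 + 571 =
    0.\<close>
  have "int 19 ^ 1 dvd lookup (c + of_int (- 1) * gsum) x" for x
    by (rule self_conjugate_dvd_lookup[OF _ pj _ S(2)]) (simp_all add: aug)
  then have d19: "19 dvd lookup (c + of_int (- 1) * gsum) x" for x by simp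
  have "(c + of_int (- 1) * gsum) * dil (- 1) (c + of_int (- 1) * gsum) = of_int (19\<^sup>2 * 121)"
    using S(2)[of "- 1"] by (simp add: aug)
  then obtain y where y: "c + of_int (- 1) * gsum = of_int 19 * y" "y * dil (- 1) y = of_int 121"
    by (rule divide_by_of_int[OF _ d19 _ that]) simp
  have lookup_y: "lookup c x - 1 = 19 * lookup y x" for x
    using S(4)[of "- 1" x] unfolding y(1) lookup_of_int_mult by simp
  have "aug c - 571 = 19 * aug y"
    using S(3)[of "- 1"] unfolding y(1) aug_of_int_mult by simp
  then have aug_y: "aug y = - 11" by (simp add: aug)
  have "of_nat 11 ^ 285 = (of_nat 1 :: 571)"
    by (rule pow) (simp add: power_mod_simps del: power_numeral)
  then have t285: "of_nat 11 ^ 285 = (1 :: 571)" by (simp only: of_nat_1)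
  \<comment> \<open>The powers 11^15 and 11^57 have orders 19 and 5, so the orbit argument applies
    with both primes.\<close>
  moreover have "285 = 15 * (19 :: nat)" "285 = 57 * (5 :: nat)" by simp_all
  ultimately have t285': "of_nat 11 ^ (15 * 19) = (1 :: 571)" "of_nat 11 ^ (57 * 5) = (1 :: 571)"
    by (simp_all only:)
  have "of_nat 11 ^ 15 = (of_nat 407 :: 571)" "of_nat 11 ^ 57 = (of_nat 387 :: 571)"
    by (rule pow, simp add: power_mod_simps del: power_numeral)+
  then have t15: "of_nat 11 ^ 15 \<noteq> (1 :: 571)" "of_nat 11 ^ 57 \<noteq> (1 :: 571)"
    by (simp_all only:) simp_all
  have "of_nat 11 ^ 2 dvd y * dil (- 1) y" by (simp add: y(2))
  then have dvd: "of_nat 11 ^ 2 dvd dil (of_nat 11) y * dil (- 1) y"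
    by (rule dvd_dil_mult_prime[OF _ t285, rotated 2]) simp_all
  have ne: "of_nat 11 \<noteq> (1 :: 571)" by simp
  obtain e where e: "dil (of_nat 11) y = single e 1 * y"
  \<comment> \<open>52 is the inverse of 11, as 52 * 11 = 572; \<kappa> = 0 because
    \<open>gsum\<close> is gone.\<close>
  proof (rule multiplier[of 121 y 52 "of_nat 11" 0])
    show "of_int 121 dvd dil (of_nat 11) y * dil (- 1) y" using dvd by simp
  qed (use aug_y y(2) in simp_all)
  obtain d where d: "dil (of_nat 11) (single d 1 * y) = single d 1 * y"
    by (rule exists_fixed_translate[OF char prime ne e])
  define k where "k = aug y - lookup y (- d)"
  have k: "k = aug (single d 1 * y) - lookup (single d 1 * y) 0"
    by (simp add: k_def aug_single_mult lookup_single_mult)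
  have "int 19 dvd k" unfolding k
    by (rule dvd_aug_minus_center[OF char prime t285'(1) t15(1) _ d]) simp
  moreover have "int 5 dvd k" unfolding k
    by (rule dvd_aug_minus_center[OF char prime t285'(2) t15(2) _ d]) simp
  \<comment> \<open>From |c - 1| \<le> 154 follows |y| \<le> 8, so k lies between -19 and -3 and
    cannot be divisible by 95.\<close>
  moreover have "- 8 \<le> lookup y (- d)" "lookup y (- d) \<le> 8"
    using c(3)[of "- d"] lookup_y[of "- d"] by auto
  ultimately show False unfolding k_def aug_y by presburger
qed

lemma no_sequence_2433602:
  assumes bin: "binary_sequence 2433602 a"
    and ac: "\<forall>t \<in> {1..2433602 - 1}. autocorrelation 2433602 a t = 2"
  shows False
proof -
  have char: "CHAR(2131) = CARD(2131)" by simp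
  have "prime (2131 :: nat)"
    by (rule prime_nat_if_no_small_divisor[of _ 46]) (simp_all add: upt_rec_numeral)
  moreover have "CARD(2131) = 2131" by simp
  ultimately have prime: "prime CARD(2131)" by (simp only:)
  have pow: "of_nat p ^ k = (of_nat b :: 2131)" if "p ^ k mod 2131 = b" for p k b
    by (rule of_nat_power_eqI[OF _ that]) simp
  obtain c :: "2131 \<Rightarrow>\<^sub>0 int" where c: "c * dil (- 1) c = of_nat (780\<^sup>2) + of_nat 571 * gsum"
      "aug c \<ge> 0" "\<And>x. \<bar>lookup c x\<bar> \<le> int 571"
    by (rule fold_sequence[OF bin ac char, of 780 571]) auto
  note S = shift_by_gsum[OF c(1)]
  have "(aug c)\<^sup>2 = 1351\<^sup>2" using S(1) by simp
  then have aug: "aug c = 1351" using c(2) by (rule power2_eq_imp_eq) simp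
  have "of_nat 2 ^ 1065 = (of_nat 2130 :: 2131)"
    by (rule pow) (simp add: power_mod_simps del: power_numeral)
  also have "of_nat 2130 = (- 1 :: 2131)" by simp
  finally have pj: "of_nat 2 ^ 1065 = (- 1 :: 2131)" .
  \<comment> \<open>Here 571 - 2 * 1351 + 2131 = 0, and 2^4 divides 780^2.\<close>
  have "int 2 ^ 2 dvd lookup (c + of_int (- 1) * gsum) x" for x
    by (rule self_conjugate_dvd_lookup[OF _ pj _ S(2)]) (simp_all add: aug)
  then have four: "4 dvd lookup (c + of_int (- 1) * gsum) x" for x by simp
  have "of_nat 3 ^ 71 = (of_nat 2130 :: 2131)"
    by (rule pow) (simp add: power_mod_simps del: power_numeral)
  also have "of_nat 2130 = (- 1 :: 2131)" by simp
  finally have pj: "of_nat 3 ^ 71 = (- 1 :: 2131)" .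
  have "int 3 ^ 1 dvd lookup (c + of_int (- 1) * gsum) x" for x
    by (rule self_conjugate_dvd_lookup[OF _ pj _ S(2)]) (simp_all add: aug)
  then have three: "3 dvd lookup (c + of_int (- 1) * gsum) x" for x by simp
  have d12: "12 dvd lookup (c + of_int (- 1) * gsum) x" for x
    using three[of x] four[of x] by presburger
  have "(c + of_int (- 1) * gsum) * dil (- 1) (c + of_int (- 1) * gsum) = of_int (12\<^sup>2 * 4225)"
    using S(2)[of "- 1"] by (simp add: aug)
  then obtain y where y: "c + of_int (- 1) * gsum = of_int 12 * y" "y * dil (- 1) y = of_int 4225"
    by (rule divide_by_of_int[OF _ d12 _ that]) simp
  have lookup_y: "lookup c x - 1 = 12 * lookup y x" for x
    using S(4)[of "- 1" x] unfolding y(1) lookup_of_int_mult by simp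
  have "aug c - 2131 = 12 * aug y"
    using S(3)[of "- 1"] unfolding y(1) aug_of_int_mult by simp
  then have aug_y: "aug y = - 65" by (simp add: aug)
  have "of_nat 13 ^ 355 = (of_nat 1 :: 2131)"
    by (rule pow) (simp add: power_mod_simps del: power_numeral)
  then have t355: "of_nat 13 ^ 355 = (1 :: 2131)" by (simp only: of_nat_1)
  moreover have "355 = 5 * (71 :: nat)" "355 = 71 * (5 :: nat)" by simp_all
  ultimately have t355': "of_nat 13 ^ (5 * 71) = (1 :: 2131)" "of_nat 13 ^ (71 * 5) = (1 :: 2131)"
    by (simp_all only:)
  have "of_nat 13 ^ 5 = (of_nat 499 :: 2131)" "of_nat 13 ^ 71 = (of_nat 1780 :: 2131)"
    by (rule pow, simp add: power_mod_simps del: power_numeral)+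
  then have t5: "of_nat 13 ^ 5 \<noteq> (1 :: 2131)" "of_nat 13 ^ 71 \<noteq> (1 :: 2131)"
    by (simp_all only:) simp_all
  have "(of_nat 13 ^ 2 :: 2131 \<Rightarrow>\<^sub>0 int) * 25 = of_int 4225" by simp
  then have "of_nat 13 ^ 2 dvd y * dil (- 1) y" unfolding y(2) by (metis dvd_triv_left)
  then have dvd13: "of_nat 13 ^ 2 dvd dil (of_nat 13) y * dil (- 1) y"
    by (rule dvd_dil_mult_prime[OF _ t355, rotated 2]) simp_all
  \<comment> \<open>13 is a power of 5 modulo 2131, so dilation by 13 also preserves divisibility by
    the factor 5^2 of 4225.\<close>
  have f564: "of_nat 5 ^ 564 = (of_nat 13 :: 2131)"
    by (rule pow) (simp add: power_mod_simps del: power_numeral)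
  have "of_nat 5 ^ 1065 = (of_nat 1 :: 2131)"
    by (rule pow) (simp add: power_mod_simps del: power_numeral)
  then have f1065: "of_nat 5 ^ 1065 = (1 :: 2131)" by (simp only: of_nat_1)
  have "(of_nat 5 ^ 2 :: 2131 \<Rightarrow>\<^sub>0 int) * 169 = of_int 4225" by simp
  then have "of_nat 5 ^ 2 dvd y * dil (- 1) y" unfolding y(2) by (metis dvd_triv_left)
  then have "of_nat 5 ^ 2 dvd dil (of_nat 5 ^ 564) y * dil (- 1) y"
    by (rule dvd_dil_mult_prime_power[OF _ f1065, rotated 2]) simp_all
  then have "of_nat 5 ^ 2 dvd dil (of_nat 13) y * dil (- 1) y" by (simp only: f564)
  then have dvd: "of_int (169 * 25) dvd dil (of_nat 13) y * dil (- 1) y"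
    using dvd13 by (intro of_int_mult_dvd_if_bezout[of _ _ _ 4 "- 27"]) simp_all
  have ne: "of_nat 13 \<noteq> (1 :: 2131)" by simp
  obtain e where e: "dil (of_nat 13) y = single e 1 * y"
  proof (rule multiplier[of 4225 y 164 "of_nat 13" 0])
    show "of_int 4225 dvd dil (of_nat 13) y * dil (- 1) y" using dvd by simp
  qed (use aug_y y(2) in simp_all)
  obtain d where d: "dil (of_nat 13) (single d 1 * y) = single d 1 * y"
    by (rule exists_fixed_translate[OF char prime ne e])
  define k where "k = aug y - lookup y (- d)"
  have k: "k = aug (single d 1 * y) - lookup (single d 1 * y) 0"
    by (simp add: k_def aug_single_mult lookup_single_mult)
  have "int 71 dvd k" unfolding k
    by (rule dvd_aug_minus_center[OF char prime t355'(1) t5(1) _ d]) simp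
  moreover have "int 5 dvd k" unfolding k
    by (rule dvd_aug_minus_center[OF char prime t355'(2) t5(2) _ d]) simp
  \<comment> \<open>Now |c - 1| \<le> 572, hence |y| \<le> 47 and k lies between -112 and -18,
    excluding multiples of 355.\<close>
  moreover have "- 47 \<le> lookup y (- d)" "lookup y (- d) \<le> 47"
    using c(3)[of "- d"] lookup_y[of "- d"] by auto
  ultimately show False unfolding k_def aug_y by presburger
qed

lemma no_sequence_12546:
  assumes bin: "binary_sequence 12546 a"
    and ac: "\<forall>t \<in> {1..12546 - 1}. autocorrelation 12546 a t = 2"
  shows False
proof -
  have char: "CHAR(6273) = CARD(6273)" by simp
  obtain c :: "6273 \<Rightarrow>\<^sub>0 int" where c: "c * dil (- 1) c = of_nat (56\<^sup>2) + of_nat 1 * gsum"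
      "aug c \<ge> 0" "\<And>x. \<bar>lookup c x\<bar> \<le> int 1"
    by (rule fold_sequence[OF bin ac char, of 56 1]) auto
  note S = shift_by_gsum[OF c(1)]
  have "(aug c)\<^sup>2 = 97\<^sup>2" using S(1) by simp
  then have aug: "aug c = 97" using c(2) by (rule power2_eq_imp_eq) simp
  define z where "z = c + of_int 15 * gsum"
  \<comment> \<open>Modulo 3136 the \<open>gsum\<close> coefficient for a shift k is (k + 97)^2,
    which requires k \<equiv> -97 \<equiv> 15 modulo 56.\<close>
  have "int 1 + 2 * 15 * aug c + 15\<^sup>2 * int CARD(6273) = 3136 * 451" by (simp add: aug)
  then have "z * dil (- 1) z = of_nat (56\<^sup>2) + of_int (3136 * 451) * gsum"
    using S(2)[of 15] by (simp only: z_def)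
  also have "of_nat (56\<^sup>2) = (of_int 3136 :: 6273 \<Rightarrow>\<^sub>0 int)" by simp
  finally have zz: "z * dil (- 1) z = of_int 3136 * (1 + of_int 451 * gsum)"
    by (simp only: of_int_mult distrib_left mult_1_right mult.assoc)
  \<comment> \<open>With q = 6273 / 3 one has 3 q = 0 and q^2 = 0, so v = 1 + q and t = 1 + 2 q are
    mutually inverse of order 3.\<close>
  define t v q :: 6273 where "t = 4183" and "v = 2092" and "q = 2091"
  have vt: "v * t = 1" by (simp add: t_def v_def)
  have pow: "of_nat p ^ k = (of_nat b :: 6273)" if "p ^ k mod 6273 = b" for p k b
    by (rule of_nat_power_eqI[OF _ that]) simp
  have "of_nat 2 ^ 120 = (of_nat 1 :: 6273)" "of_nat 7 ^ 240 = (of_nat 1 :: 6273)"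
    by (rule pow, simp add: power_mod_simps del: power_numeral)+
  then have one: "of_nat 2 ^ 120 = (1 :: 6273)" "of_nat 7 ^ 240 = (1 :: 6273)"
    by (simp_all only: of_nat_1)
  have "of_nat 2 ^ 40 = (of_nat 4183 :: 6273)" "of_nat 7 ^ 160 = (of_nat 4183 :: 6273)"
    by (rule pow, simp add: power_mod_simps del: power_numeral)+
  moreover have "of_nat 4183 = t" by (simp add: t_def)
  ultimately have t: "of_nat 2 ^ 40 = t" "of_nat 7 ^ 160 = t"
    by (simp_all only:)
  have "of_int 64 dvd z * dil (- 1) z"
    by (simp only: of_int_dvd_iff zz lookup_of_int_mult) simp
  then have "of_nat 2 ^ 6 dvd z * dil (- 1) z" by simp
  then have "of_nat 2 ^ 6 dvd dil (of_nat 2 ^ 40) z * dil (- 1) z"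
    by (rule dvd_dil_mult_prime_power[OF _ one(1), rotated 2]) simp_all
  then have dvd2: "of_nat 2 ^ 6 dvd dil t z * dil (- 1) z" by (simp only: t)
  have "of_int 49 dvd z * dil (- 1) z"
    by (simp only: of_int_dvd_iff zz lookup_of_int_mult) simp
  then have "of_nat 7 ^ 2 dvd z * dil (- 1) z" by simp
  then have "of_nat 7 ^ 2 dvd dil (of_nat 7 ^ 160) z * dil (- 1) z"
    by (rule dvd_dil_mult_prime_power[OF _ one(2), rotated 2]) simp_all
  then have "of_nat 7 ^ 2 dvd dil t z * dil (- 1) z" by (simp only: t)
  then have "of_int (64 * 49) dvd dil t z * dil (- 1) z"
    using dvd2 by (intro of_int_mult_dvd_if_bezout[of _ _ _ "- 13" 17]) simp_all
  then have dvd: "of_int 3136 dvd dil t z * dil (- 1) z" by simp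
  have "aug z = 97 + 15 * 6273" using S(3)[of 15] by (simp add: z_def aug)
  then obtain e where e: "dil t z = single e 1 * z"
    using multiplier[OF _ _ vt zz dvd] by auto
  have cv: "lookup c (v * x) = lookup c (x - e)" for x
  proof -
    have "lookup z (v * x) = lookup z (x - e)"
      using arg_cong[OF e, of "\<lambda>h. lookup h x"] by (simp add: lookup_dil[OF vt] lookup_single_mult)
    then show ?thesis unfolding z_def S(4) by simp
  qed
  have "v * v\<^sup>2 = 1" and v3: "1 + v + v\<^sup>2 = 3" by (simp_all add: v_def)
  then have va: "v * (v\<^sup>2 * x) = x" and vb: "v * (v * x) = v\<^sup>2 * x" for x
    by (simp_all add: power2_eq_square flip: mult.assoc)
  \<comment> \<open>Apply \<open>cv\<close> three times; since v^3 = 1 and 1 + v + v^2 = 3, only a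
    translation by 3 e is left.\<close>
  have "lookup c x = lookup c (x - 3 * e)" for x
  proof -
    have "lookup c x = lookup c (v * (v\<^sup>2 * x))"
      by (simp only: va)
    also have "\<dots> = lookup c (v\<^sup>2 * x - e)" by (simp only: cv)
    also have "v\<^sup>2 * x - e = v * (v * x - v\<^sup>2 * e)"
      by (simp only: right_diff_distrib va vb)
    also have "lookup c \<dots> = lookup c (v * x - v\<^sup>2 * e - e)" by (simp only: cv)
    also have "v * x - v\<^sup>2 * e - e = v * (x - v * e - v\<^sup>2 * e)"
      by (simp only: right_diff_distrib va vb)
    also have "lookup c \<dots> = lookup c (x - v * e - v\<^sup>2 * e - e)" by (simp only: cv)
    also have "x - v * e - v\<^sup>2 * e - e = x - (1 + v + v\<^sup>2) * e" by (simp add: algebra_simps)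
    finally show ?thesis by (simp only: v3)
  qed
  then have period: "lookup c (y - 3 * e) = lookup c y" for y by simp
  have corr: "(\<Sum>y\<in>UNIV. lookup c y * lookup c (y - x)) = (if x = 0 then 3137 else 1)" for x
    using arg_cong[OF c(1), of "\<lambda>h. lookup h x"]
    by (simp add: lookup_mult_dil_minus lookup_add lookup_numeral when_def)
  \<comment> \<open>If the period 3 e were nonzero, the autocorrelation there would be both 3137 and
    1.\<close>
  have e3: "3 * e = 0"
    using corr[of "3 * e"] corr[of 0] unfolding period by (simp split: if_splits)
  have surj: "\<exists>i<6273. x = of_nat i" for x :: 6273
  proof -
    have "x \<in> of_nat ` {..<CARD(6273)}"
      by (simp only: bij_betw_imp_surj_on[OF bij_betw_of_nat[OF char]] UNIV_I)
    then show ?thesis by auto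
  qed
  obtain i where i: "e = of_nat i" using surj by blast
  have "of_nat (3 * i) = (0 :: 6273)" using e3 i by simp
  then have "6273 dvd 3 * i" by (simp only: of_nat_eq_0_iff_char_dvd) simp
  then have "2091 dvd i" using dvd_times_left_cancel_iff[of 3 2091 i] by simp
  then obtain l' where "i = 2091 * l'" by (elim dvdE)
  define l :: 6273 where "l = of_nat l'"
  have eq: "e = q * l" using i \<open>i = 2091 * l'\<close> by (simp add: l_def q_def)
  have qq: "q * q = 0" and q3: "q + q + q = 0" and v: "v = 1 + q" by (simp_all add: q_def v_def)
  \<comment> \<open>Take x = y + e in \<open>cv\<close>: since e = q l and q^2 = 0, multiplication
    by v becomes a shift by q (y + l).\<close>
  have cq: "lookup c (y + q * (y + l)) = lookup c y" for y
  proof -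
    have "v * (y + e) = y + q * (y + l) + (q * q) * l" by (simp add: v eq algebra_simps)
    then have "v * (y + e) = y + q * (y + l)" by (simp add: qq)
    then show ?thesis using cv[of "y + e"] by simp
  qed
  have trichotomy: "q * x = 0 \<or> q * x = q \<or> q * x = q + q" for x
  proof -
    obtain j where "x = of_nat j" using surj by blast
    also have "\<dots> = of_nat (3 * (j div 3) + j mod 3)" by simp
    finally have "q * x = (q + q + q) * of_nat (j div 3) + q * of_nat (j mod 3)"
      by (simp only: of_nat_add of_nat_mult) (simp add: algebra_simps)
    then have "q * x = q * of_nat (j mod 3)" by (simp only: q3 mult_zero_left add_0)
    moreover have "j mod 3 = 0 \<or> j mod 3 = 1 \<or> j mod 3 = 2" by linarith
    ultimately show ?thesis by (auto simp: algebra_simps)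
  qed
  have same: "lookup c (y + q) = lookup c y" if "q * (y + l) \<noteq> 0" for y
  proof (cases "q * (y + l) = q")
    case True
    then show ?thesis using cq[of y] by simp
  next
    case False
    then have qy: "q * (y + l) = q + q" using that trichotomy by blast
    \<comment> \<open>In this case the shift is 2 q; doing it twice gives 4 q = q.\<close>
    have "q * (y + (q + q) + l) = q * (y + l) + (q * q + q * q)" by (simp add: algebra_simps)
    then have "q * (y + (q + q) + l) = q + q" by (simp add: qq qy)
    with cq[of "y + (q + q)"] have "lookup c (y + (q + q) + (q + q)) = lookup c (y + (q + q))" by simp
    moreover have "y + (q + q) + (q + q) = y + q" using q3 by (simp add: algebra_simps)
    moreover have "lookup c (y + (q + q)) = lookup c y" using cq[of y] qy by simp
    ultimately show ?thesis by metis
  qed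
  define Z where "Z = {y. q * (y + l) = 0}"
  \<comment> \<open>The sum of T is the difference 3137 - 1 of the autocorrelations at 0 and -q; T
    vanishes off Z.\<close>
  define T where "T y = lookup c y * lookup c y - lookup c y * lookup c (y + q)" for y
  have "- q \<noteq> 0" by (simp add: q_def)
  then have "3136 = (\<Sum>y\<in>UNIV. T y)"
    using corr[of 0] corr[of "- q"] by (simp add: T_def sum_subtractf)
  also have "\<dots> = (\<Sum>y\<in>Z. T y)"
    by (rule sum.mono_neutral_right) (auto simp: Z_def T_def same)
  finally have TZ: "(\<Sum>y\<in>Z. T y) = 3136" by simp
  have Zq: "y + q \<in> Z" if "y \<in> Z" for y using that by (simp add: Z_def algebra_simps qq)
  have bij: "bij_betw (\<lambda>y. y + q) Z Z"
  proof (rule bij_betw_byWitness[where f' = "\<lambda>y. y + q + q"])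
    have "y + q + q + q = y" for y using q3 by (simp add: add.assoc)
    then show "\<forall>y\<in>Z. y + q + q + q = y" "\<forall>y\<in>Z. y + q + q + q = y" by simp_all
  qed (blast intro: Zq)+
  have TZq: "(\<Sum>y\<in>Z. F (y + q)) = (\<Sum>y\<in>Z. F y)" for F :: "6273 \<Rightarrow> int"
    by (rule sum.reindex_bij_betw[OF bij])
  have "3 * 3136 = (\<Sum>y\<in>Z. T y) + (\<Sum>y\<in>Z. T (y + q)) + (\<Sum>y\<in>Z. T (y + q + q))"
    using TZ TZq[of T] TZq[of "\<lambda>y. T (y + q)"] by simp
  also have "\<dots> = (\<Sum>y\<in>Z. T y + T (y + q) + T (y + q + q))"
    by (simp only: sum.distrib)
  also have "\<dots> \<le> (\<Sum>y\<in>Z. 4)"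
  proof (rule sum_mono)
    fix y
    have *: "lookup c x = - 1 \<or> lookup c x = 0 \<or> lookup c x = 1" for x
      using c(3)[of x] by auto
    have "y + q + q + q = y" using q3 by (simp add: add.assoc)
    \<comment> \<open>Over a coset of the subgroup of order 3 the terms add up to half the sum of
      the squared differences of three values in {-1, 0, 1}.\<close>
    then show "T y + T (y + q) + T (y + q + q) \<le> 4"
      unfolding T_def using *[of y] *[of "y + q"] *[of "y + q + q"] by auto
  qed
  also have "\<dots> = 4 * int (card Z)" by simp
  finally have "2352 \<le> card Z" by simp
  moreover have "card Z \<le> 2091"
  proof -
    \<comment> \<open>q annihilates exactly the multiples of 3, so Z is a translate of the subgroup
      they form.\<close>
    have "Z \<subseteq> (\<lambda>k. of_nat (3 * k) - l) ` {..<2091}"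
    proof
      fix y assume "y \<in> Z"
      obtain j where j: "j < 6273" "y + l = of_nat j" using surj by blast
      have "q * (y + l) = 0" using \<open>y \<in> Z\<close> by (simp add: Z_def)
      then have "of_nat (2091 * j) = (0 :: 6273)" by (simp add: j q_def)
      then have "6273 dvd 2091 * j" by (simp only: of_nat_eq_0_iff_char_dvd) simp
      then have "3 dvd j" using dvd_times_left_cancel_iff[of 2091 3 j] by simp
      then obtain k where k: "j = 3 * k" by (elim dvdE)
      have "y = of_nat (3 * k) - l" using j k by (metis add_diff_cancel_right')
      then show "y \<in> (\<lambda>k. of_nat (3 * k) - l) ` {..<2091}" using j k by auto
    qed
    then have "card Z \<le> card ((\<lambda>k. of_nat (3 * k) - l) ` {..<2091})" by (intro card_mono) auto
    also have "\<dots> \<le> 2091" using card_image_le[of "{..<2091}"] by fastforce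
    finally show ?thesis .
  qed
  ultimately show False by simp
qed

section \<open>The Pell equation\<close>

text \<open>Divide r + m sqrt 3 by the fundamental unit 2 + sqrt 3. The rational bound 173/100 <
  sqrt 3 yields m' \<le> 0.27 m, slightly below 10/37.\<close>

lemma pell_solution_descent:
  fixes m r :: nat
  assumes "r\<^sup>2 = 3 * m\<^sup>2 + 1" "m > 0"
  obtains m' r' where "r'\<^sup>2 = 3 * m'\<^sup>2 + 1" "m = 2 * m' + r'" "r = 2 * r' + 3 * m'" "37 * m' \<le> 10 * m"
proof -
  have "r\<^sup>2 \<le> (2 * m)\<^sup>2" using assms by (simp add: power_mult_distrib)
  then have r1: "r \<le> 2 * m" by (rule power2_le_imp_le) simp
  have "(173 * m)\<^sup>2 \<le> (100 * r)\<^sup>2" using assms by (simp add: power_mult_distrib)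
  then have r2: "173 * m \<le> 100 * r" by (rule power2_le_imp_le) simp
  define m' where "m' = 2 * m - r"
  define r' where "r' = 2 * r - 3 * m"
  have i: "int m' = 2 * int m - int r" "int r' = 2 * int r - 3 * int m"
    using r1 r2 by (simp_all add: m'_def r'_def)
  have "(int r)\<^sup>2 = 3 * (int m)\<^sup>2 + 1" using assms(1) by (metis of_nat_power of_nat_Suc of_nat_mult of_nat_numeral Suc_eq_plus1 add.commute)
  then have "(int r')\<^sup>2 = 3 * (int m')\<^sup>2 + 1"
    unfolding i by (simp add: power2_eq_square algebra_simps)
  then have "int (r'\<^sup>2) = int (3 * m'\<^sup>2 + 1)" by simp
  then have "r'\<^sup>2 = 3 * m'\<^sup>2 + 1" by presburger
  moreover have "m = 2 * m' + r'" "r = 2 * r' + 3 * m'" "37 * m' \<le> 10 * m"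
    using i r1 r2 by linarith+
  ultimately show ?thesis by (rule that)
qed

text \<open>Descent read upwards: a complete list for m \<le> b, mapped by the fundamental unit and
  joined with (1, 0), is complete for m \<le> b' whenever 10 b' < 37 (b + 1).\<close>

lemma pell_solutions_le:
  fixes m r :: nat
  assumes "r\<^sup>2 = 3 * m\<^sup>2 + 1" "m \<le> 2910"
  shows "(r, m) \<in> {(1, 0), (2, 1), (7, 4), (26, 15), (97, 56), (362, 209), (1351, 780)}"
proof -
  define P where "P b A \<longleftrightarrow> (\<forall>r m :: nat. r\<^sup>2 = 3 * m\<^sup>2 + 1 \<longrightarrow> m \<le> b \<longrightarrow> (r, m) \<in> A)" for b A
  have step: "P b' (insert (1, 0) ((\<lambda>(r, m). (2 * r + 3 * m, 2 * m + r)) ` A))"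
    if A: "P b A" and bound: "10 * b' < 37 * Suc b" for A b b'
    unfolding P_def
  proof (intro allI impI)
    fix r m :: nat
    assume sol: "r\<^sup>2 = 3 * m\<^sup>2 + 1" and m: "m \<le> b'"
    show "(r, m) \<in> insert (1, 0) ((\<lambda>(r, m). (2 * r + 3 * m, 2 * m + r)) ` A)"
    proof (cases "m = 0")
      case True
      then show ?thesis using sol by (simp add: power2_eq_square)
    next
      case False
      then obtain m' r' where *: "r'\<^sup>2 = 3 * m'\<^sup>2 + 1" "m = 2 * m' + r'" "r = 2 * r' + 3 * m'"
          "37 * m' \<le> 10 * m"
        using pell_solution_descent[OF sol] by blast
      then have "37 * m' < 37 * Suc b" using bound m by linarith
      then have "m' \<le> b" by simp
      then have "(r', m') \<in> A" using A * unfolding P_def by blast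
      then show ?thesis using * by (auto intro!: rev_image_eqI)
    qed
  qed
  have "P 0 {(1, 0)}" by (simp add: P_def power2_eq_square)
  from step[OF this, of 1] have "P 1 {(1, 0), (2, 1)}" by (simp del: One_nat_def flip: numeral_2_eq_2)
  from step[OF this, of 4] have "P 4 {(1, 0), (2, 1), (7, 4)}" by (simp del: One_nat_def flip: numeral_2_eq_2)
  from step[OF this, of 15] have "P 15 {(1, 0), (2, 1), (7, 4), (26, 15)}" by (simp del: One_nat_def flip: numeral_2_eq_2)
  from step[OF this, of 57] have "P 57 {(1, 0), (2, 1), (7, 4), (26, 15), (97, 56)}" by (simp del: One_nat_def flip: numeral_2_eq_2)
  from step[OF this, of 213] have "P 213 {(1, 0), (2, 1), (7, 4), (26, 15), (97, 56), (362, 209)}"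
    by (simp del: One_nat_def flip: numeral_2_eq_2)
  from step[OF this, of 790]
  have "P 790 {(1, 0), (2, 1), (7, 4), (26, 15), (97, 56), (362, 209), (1351, 780)}" by (simp del: One_nat_def flip: numeral_2_eq_2)
  \<comment> \<open>The image also contains the next solution (5042, 2911), which the bound on m
    then discards.\<close>
  from step[OF this, of 2910]
  have "P 2910 {(1, 0), (2, 1), (7, 4), (26, 15), (97, 56), (362, 209), (1351, 780), (5042, 2911)}"
    by (simp del: One_nat_def flip: numeral_2_eq_2)
  then have "(r, m) \<in> {(1, 0), (2, 1), (7, 4), (26, 15), (97, 56), (362, 209), (1351, 780), (5042, 2911)}"
    using assms unfolding P_def by blast
  then show ?thesis using assms(2) by auto
qed

theorem theorem3p9:
  fixes n :: nat
  assumes "6 < n" and "n \<le> 33895685"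
  shows "\<not> (\<exists>a. binary_sequence n a \<and> (\<forall>t \<in> {1..n - 1}. autocorrelation n a t = 2))"
proof
  assume "\<exists>a. binary_sequence n a \<and> (\<forall>t \<in> {1..n - 1}. autocorrelation n a t = 2)"
  then obtain a where a: "binary_sequence n a" "\<forall>t \<in> {1..n - 1}. autocorrelation n a t = 2"
    by blast
  obtain m r where mr: "n = 4 * m\<^sup>2 + 2" "r\<^sup>2 = 3 * m\<^sup>2 + 1"
    using sequence_parameters[OF a] assms by auto
  \<comment> \<open>The solution m = 2911 would give n = 33895686, one above the range.\<close>
  have "m\<^sup>2 < 2911\<^sup>2" using assms mr by simp
  then have "m < 2911" by (rule power_less_imp_less_base) simp
  then have "m \<le> 2910" by simp
  \<comment> \<open>The solutions m = 0 and m = 1 give n = 2 and n = 6, excluded by 6 < n.\<close>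
  from pell_solutions_le[OF mr(2) this] mr(1) assms
  consider "n = 66" | "n = 902" | "n = 12546" | "n = 174726" | "n = 2433602" by auto
  then show False
    using a no_sequence_66 no_sequence_902 no_sequence_12546 no_sequence_174726 no_sequence_2433602
    by cases blast+
qed

end
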